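(* For every $z\in\mathbf C_\infty$ and every $l\in\{0,\dots,d-1\}$, $\lim_{N\to\infty}e_{\varepsilon_{N,l}}(z)=e_{d-1-l}(z)$, where $\varepsilon_{N,l}=q^{-dN-l}$. Consequently the quantum exponential $\exp^{\rm qt}_f(z):=\lim_{\varepsilon\to0}e_\varepsilon(z)$ (the multivalued limit) equals $\{e_i(z): i=0,\dots,d-1\}$.
   Context: Let $q$ be a power of a prime $p$, $A=\mathbb F_q[T]$, $k_\infty=\mathbb F_q((1/T))$ with $|T|=q$, $\mathbf C_\infty$ the completion of an algebraic closure of $k_\infty$; for $x\in k_\infty^\times$, $\deg x=\log_q|x|$ and ${\rm sgn}(x)\in\mathbb F_q^\times$ is the leading coefficient of the $1/T$-expansion. Let $a\in A$ be monic of degree $d\ge1$, $b\in\mathbb F_q^\times$, $f\in k_\infty$ the root of $X^2-aX-b$ with $|f|=q^d$; $A_{\infty_1}=\mathbb F_q[f,fT,\dots,fT^{d-1}]$ and $\mathfrak a_i=(f,fT,\dots,fT^i)\subset A_{\infty_1}$. For $\varepsilon>0$ let $\Lambda_\varepsilon(f)=\{x\in A:|xf-y|<\varepsilon\text{ for some }y\in A\}$. Let $\pi=f^{-1/d}$ if $p\nmid d$ and $\pi=(fT)^{-1/(d+1)}$ otherwise (roots in $k_\infty$ of sign $1$). For $\Lambda$ equal to some $\Lambda_\varepsilon(f)$ or some $\mathfrak a_i$ define $\eta_\Lambda=\lim_{M\to\infty}\prod_{0\ne\lambda\in\Lambda,\deg\lambda=M}{\rm sgn}(\lambda)$, $Z_\Lambda(u)=\sum_{0\ne\lambda\in\Lambda}u^{\deg\lambda}$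 (a rational function of $u$), $t_\Lambda=(q-1)Z_\Lambda'(1)$, $\langle\lambda\rangle=\lambda\pi^{\deg\lambda}/{\rm sgn}(\lambda)$, $u_\Lambda=\lim_{M\to\infty}\prod_{0\ne\lambda\in\Lambda,\deg\lambda\le M}\langle\lambda\rangle$, and let $\xi_\Lambda\in\mathbf C_\infty$ satisfy $\xi_\Lambda^{q-1}=\eta_\Lambda^{-1}\pi^{-t_\Lambda}u_\Lambda^{q-1}$. Write $\xi_\varepsilon=\xi_{\Lambda_\varepsilon(f)}$, $\xi_i=\xi_{\mathfrak a_i}$. For a discrete $\mathbb F_q$-subspace $L\subset\mathbf C_\infty$, $\exp_L(z)=z\prod_{0\ne\lambda\in L}(1-z/\lambda)$. Set $e_\varepsilon=\exp_{\xi_\varepsilon\Lambda_\varepsilon(f)}$ and $e_i=\exp_{\xi_i\mathfrak a_i}$ (these do not depend on the choice of $(q-1)$-th roots). *)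

theory Defs
  imports
    "HOL-Analysis.Analysis"
    "HOL-Computational_Algebra.Computational_Algebra"
    "HOL-Algebra.Algebraic_Closure_Type"
begin

text \<open>
  The finite field with \<open>q\<close> elements is a type \<open>'a\<close> of class \<^class>\<open>finite_field\<close>, so that
  \<open>q = CARD('a)\<close> and \<open>p = CHAR('a)\<close>. The field of Laurent series in \<open>1/T\<close> is \<open>'a fls\<close>, where
  \<^const>\<open>fls_X\<close> stands for \<open>1/T\<close>; hence \<open>T\<close> is \<^const>\<open>fls_X_inv\<close>.
\<close>

definition deg_inf :: "'a::finite_field fls \<Rightarrow> int" where
  "deg_inf x = - fls_subdegree x"

definition sgn_inf :: "'a::finite_field fls \<Rightarrow> 'a" where
  "sgn_inf x = fls_nth x (fls_subdegree x)"

text \<open>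
  This absolute value has \<open>|T| = q\<close>. The metric of the library on \<open>'a fls\<close> uses the base \<open>2\<close>
  instead of \<open>q\<close>; both induce the same topology.
\<close>

definition abs_inf :: "'a::finite_field fls \<Rightarrow> real" where
  "abs_inf x = (if x = 0 then 0 else real CARD('a) powi deg_inf x)"

definition of_A :: "'a::finite_field poly \<Rightarrow> 'a fls" where
  "of_A a = poly (map_poly fls_const a) fls_X_inv"

text \<open>
  A completion of an algebraic closure of \<open>'a fls\<close>: \<open>emb\<close> embeds the algebraic closure as a dense
  subfield of a complete field, whose absolute value \<open>dist x 0\<close> extends \<^const>\<open>abs_inf\<close>. These
  properties determine the field up to isometric isomorphism.
\<close>

locale C_infinity =
  fixes emb :: "'a::finite_field fls alg_closure \<Rightarrow> 'c::{field, complete_space}"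
  assumes emb_1: "emb 1 = 1"
    and emb_add: "emb (x + y) = emb x + emb y"
    and emb_mult: "emb (x * y) = emb x * emb y"
    and dense: "closure (range emb) = UNIV"
    and dist_diff: "dist (z :: 'c) w = dist (z - w) 0"
    and abs_mult: "dist (z * w :: 'c) 0 = dist z 0 * dist w 0"
    and abs_ultrametric: "dist (z + w :: 'c) 0 \<le> max (dist z 0) (dist w 0)"
    and abs_extends: "dist (emb (to_ac k)) 0 = abs_inf k"

definition Lambda_eps :: "'a::finite_field fls \<Rightarrow> real \<Rightarrow> 'a fls set" where
  "Lambda_eps f \<epsilon> = {of_A x | x. \<exists>y. abs_inf (of_A x * f - of_A y) < \<epsilon>}"

inductive_set A_inf1 :: "'a::finite_field fls \<Rightarrow> nat \<Rightarrow> 'a fls set"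
  for f :: "'a fls" and d :: nat where
  const: "fls_const c \<in> A_inf1 f d"
| gen: "i < d \<Longrightarrow> f * fls_X_inv ^ i \<in> A_inf1 f d"
| add: "x \<in> A_inf1 f d \<Longrightarrow> y \<in> A_inf1 f d \<Longrightarrow> x + y \<in> A_inf1 f d"
| mult: "x \<in> A_inf1 f d \<Longrightarrow> y \<in> A_inf1 f d \<Longrightarrow> x * y \<in> A_inf1 f d"

definition ideal_a :: "'a::finite_field fls \<Rightarrow> nat \<Rightarrow> nat \<Rightarrow> 'a fls set" where
  "ideal_a f d i = {\<Sum>j\<le>i. c j * (f * fls_X_inv ^ j) | c. \<forall>j\<le>i. c j \<in> A_inf1 f d}"

definition deg_slice :: "'a::finite_field fls set \<Rightarrow> nat \<Rightarrow> 'a fls set" where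
  "deg_slice \<Lambda> M = {x \<in> \<Lambda>. x \<noteq> 0 \<and> deg_inf x = int M}"

text \<open>The limit is taken in the discrete field \<open>'a\<close>, so it is the eventual value.\<close>

definition eta :: "'a::finite_field fls set \<Rightarrow> 'a" where
  "eta \<Lambda> = (THE c. \<forall>\<^sub>F M in sequentially. (\<Prod>x\<in>deg_slice \<Lambda> M. sgn_inf x) = c)"

text \<open>
  The nonzero elements of the sets \<open>\<Lambda>\<close> of interest have degree \<open>\<ge> 0\<close>, so \<open>Z\<^sub>\<Lambda>\<close> is a power series.
  As the series itself does not converge at \<open>1\<close>, \<open>Z\<^sub>\<Lambda>'(1)\<close> is the derivative at \<open>1\<close> of the rational
  function \<open>P / Q\<close> that has this expansion at \<open>0\<close>. The value \<open>t\<^sub>\<Lambda>\<close> is an integer because it serves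
  as an exponent.
\<close>

definition Z_series :: "'a::finite_field fls set \<Rightarrow> real fps" where
  "Z_series \<Lambda> = Abs_fps (\<lambda>n. real (card (deg_slice \<Lambda> n)))"

definition t_exp :: "'a::finite_field fls set \<Rightarrow> int" where
  "t_exp \<Lambda> = (THE t. \<exists>P Q :: real poly. poly Q 1 \<noteq> 0 \<and>
     Z_series \<Lambda> * fps_of_poly Q = fps_of_poly P \<and>
     real_of_int t = (real CARD('a) - 1) * deriv (\<lambda>u. poly P u / poly Q u) 1)"

definition one_unit :: "'a::finite_field fls \<Rightarrow> 'a fls \<Rightarrow> 'a fls" where
  "one_unit \<pi> x = x * \<pi> powi deg_inf x / fls_const (sgn_inf x)"

definition u_lim :: "'a::finite_field fls \<Rightarrow> 'a fls set \<Rightarrow> 'a fls" where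
  "u_lim \<pi> \<Lambda> =
     lim (\<lambda>M. \<Prod>x | x \<in> \<Lambda> \<and> x \<noteq> 0 \<and> deg_inf x \<le> int M. one_unit \<pi> x)"

text \<open>The infinite product is the unordered one, along the finite subsets of the lattice.\<close>

definition exp_lattice :: "'c::{field, t2_space} set \<Rightarrow> 'c \<Rightarrow> 'c" where
  "exp_lattice L z =
     z * Lim (finite_subsets_at_top (L - {0})) (\<lambda>F. \<Prod>x\<in>F. 1 - z / x)"

definition exp_scaled ::
  "('a::finite_field fls alg_closure \<Rightarrow> 'c::{field, t2_space}) \<Rightarrow> 'c \<Rightarrow> 'a fls set \<Rightarrow> 'c \<Rightarrow> 'c" where
  "exp_scaled emb \<xi> \<Lambda> = exp_lattice ((\<lambda>x. \<xi> * emb (to_ac x)) ` \<Lambda>)"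

text \<open>The multivalued limit as \<open>\<epsilon> \<rightarrow> 0\<close> is the set of all limit points.\<close>

definition multi_lim :: "(real \<Rightarrow> 'c::topological_space) \<Rightarrow> 'c set" where
  "multi_lim g = {w. \<exists>E :: nat \<Rightarrow> real.
     (\<forall>n. E n > 0) \<and> E \<longlonglongrightarrow> 0 \<and> (\<lambda>n. g (E n)) \<longlonglongrightarrow> w}"

end

theory Submission
  imports Defs
begin

text \<open>
  Let \<open>f' = - b / f\<close> be the conjugate of \<open>f\<close>, so that \<open>|f'| = q\<^bsup>-d\<^esup>\<close>. On the one hand
  \<open>\<aa>\<^sub>i\<close> consists of the \<open>u \<in> A[f]\<close> whose conjugate \<open>u'\<close> satisfies \<open>|u'| \<le> q\<^bsup>i-d\<^esup>\<close>; on the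
  other hand \<open>x f - y = - (x f' - (a x - y))\<close>, so \<open>\<Lambda>\<^sub>\<epsilon>(f)\<close> consists of the \<open>f\<close>-coefficients of the
  elements of \<open>A[f]\<close> whose conjugate is smaller than \<open>\<epsilon>\<close>. As \<open>f\<close> is a unit of \<open>A[f]\<close>, with
  \<open>i = d - 1 - l\<close> the map \<open>u \<mapsto> (f\<^bsup>N\<^esup> u - f'\<^bsup>N\<^esup> u') / (f - f')\<close> is a bijection from
  \<open>\<aa>\<^sub>i\<close> to \<open>\<Lambda>\<^sub>\<epsilon>(f)\<close> for \<open>\<epsilon> = q\<^bsup>-dN-l\<^esup>\<close>. It multiplies every \<open>u\<close> by
  \<open>g = f\<^bsup>N\<^esup> / (f - f')\<close>, up to a factor that tends to \<open>1\<close> uniformly in \<open>u\<close>.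

  Such a map shifts degrees by \<open>s = deg g\<close> and preserves signs. Hence it does not change \<open>\<eta>\<^sub>\<Lambda>\<close>; it lowers
  \<open>t\<^sub>\<Lambda>\<close> by \<open>s (q - 1)\<close>, because \<open>Z\<^sub>\<Lambda>(1) = - 1\<close>; and it changes \<open>u\<^sub>\<Lambda>\<close> by the factor
  \<open>(g \<pi>\<^bsup>s\<^esup>)\<^bsup>-1\<^esup>\<close> up to a factor close to \<open>1\<close>, because the number of \<open>\<lambda>\<close> with
  \<open>deg \<lambda> \<le> M\<close> is a power of \<open>q\<close>, and one-units raised to high powers of \<open>q\<close> tend to \<open>1\<close>.
  So \<open>\<xi>\<^sub>\<Lambda>\<close> is divided by \<open>g\<close> up to a constant of the finite field and a factor close to \<open>1\<close>: the
  scaled lattices agree up to factors uniformly close to \<open>1\<close>, and the infinite products converge.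
\<close>

section \<open>Ultrametric norms and Laurent series\<close>

text \<open>Stated abstractly because the same estimates serve twice: for \<open>abs_inf\<close> on
  Laurent series and for the absolute value \<open>dist z 0\<close> of the completed algebraic
  closure.\<close>

locale ultrametric_norm =
  fixes nrm :: "'k::field \<Rightarrow> real"
  assumes nrm_nonneg: "0 \<le> nrm x"
    and nrm_eq_0_iff: "nrm x = 0 \<longleftrightarrow> x = 0"
    and nrm_mult: "nrm (x * y) = nrm x * nrm y"
    and nrm_add_le: "nrm (x + y) \<le> max (nrm x) (nrm y)"
begin

lemma nrm_0 [simp]: "nrm 0 = 0"
  by (simp add: nrm_eq_0_iff)

lemma nrm_1 [simp]: "nrm 1 = 1"
  using nrm_mult[of 1 1] nrm_eq_0_iff[of 1] by simp

lemma nrm_minus [simp]: "nrm (- x) = nrm x"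
proof -
  have "nrm (- 1) ^ 2 = 1"
    by (simp add: power2_eq_square flip: nrm_mult)
  then have "nrm (- 1) = 1"
    using nrm_nonneg[of "- 1"] by (simp add: power2_eq_1_iff)
  then show ?thesis
    using nrm_mult[of "- 1" x] by simp
qed

lemma nrm_diff_le: "nrm (x - y) \<le> max (nrm x) (nrm y)"
  using nrm_add_le[of x "- y"] by simp

lemma nrm_add_bound: "nrm x \<le> e \<Longrightarrow> nrm y \<le> e \<Longrightarrow> nrm (x + y) \<le> e"
  using nrm_add_le[of x y] by simp

lemma nrm_diff_bound: "nrm x \<le> e \<Longrightarrow> nrm y \<le> e \<Longrightarrow> nrm (x - y) \<le> e"
  using nrm_diff_le[of x y] by simp

lemma nrm_commute: "nrm (x - y) = nrm (y - x)"
  using nrm_minus[of "x - y"] by simp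

lemma nrm_inverse: "nrm (inverse x) = inverse (nrm x)"
proof (cases "x = 0")
  case False
  then have "nrm x * nrm (inverse x) = 1"
    by (simp flip: nrm_mult)
  then show ?thesis
    by (metis inverse_unique)
qed simp

lemma nrm_divide: "nrm (x / y) = nrm x / nrm y"
  by (simp add: divide_inverse nrm_mult nrm_inverse)

lemma nrm_power: "nrm (x ^ n) = nrm x ^ n"
  by (induction n) (simp_all add: nrm_mult)

lemma nrm_prod: "nrm (\<Prod>i\<in>I. a i) = (\<Prod>i\<in>I. nrm (a i))"
  by (induction I rule: infinite_finite_induct) (simp_all add: nrm_mult)

text \<open>If \<open>x + y\<close> were smaller than \<open>x\<close>, then
  \<open>x = (x + y) - y\<close> would be a difference of two elements smaller than
  \<open>x\<close>.\<close>

lemma nrm_add_eq: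
  assumes "nrm y < nrm x"
  shows "nrm (x + y) = nrm x"
  using assms nrm_add_le[of x y] nrm_diff_le[of "x + y" y] by (auto simp: max_def split: if_splits)

lemma nrm_diff_eq:
  assumes "nrm y < nrm x"
  shows "nrm (x - y) = nrm x"
  using nrm_add_eq[of "- y" x] assms by simp

lemma nrm_eq_1_of_near_1: "nrm (x - 1) < 1 \<Longrightarrow> nrm x = 1"
  using nrm_add_eq[of "x - 1" 1] by simp

text \<open>One factor is exchanged at a time, and the ultrametric inequality keeps the errors from
  adding up, so the number of factors does not enter. The weights \<open>m i\<close> admit factors
  larger than 1, as they occur in the products for the exponential.\<close>

lemma nrm_prod_diff_le:
  assumes "finite I" "0 \<le> \<epsilon>"
    and "\<And>i. i \<in> I \<Longrightarrow> nrm (a i) \<le> m i" "\<And>i. i \<in> I \<Longrightarrow> nrm (b i) \<le> m i"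
    and "\<And>i. i \<in> I \<Longrightarrow> nrm (a i - b i) \<le> \<epsilon> * m i"
  shows "nrm ((\<Prod>i\<in>I. a i) - (\<Prod>i\<in>I. b i)) \<le> \<epsilon> * (\<Prod>i\<in>I. m i)"
  using assms(1,3-5)
proof (induction I rule: finite_induct)
  case empty
  then show ?case using assms(2) by simp
next
  case (insert i I)
  let ?A = "\<Prod>i\<in>I. a i" and ?B = "\<Prod>i\<in>I. b i" and ?M = "\<Prod>i\<in>I. m i"
  have m: "0 \<le> m j" if "j \<in> insert i I" for j
    using insert.prems(1)[OF that] nrm_nonneg[of "a j"] by linarith
  have IH: "nrm (?A - ?B) \<le> \<epsilon> * ?M"
    using insert by auto
  have B: "nrm ?B \<le> ?M"
    unfolding nrm_prod using insert.prems(2) by (intro prod_mono) (auto simp: nrm_nonneg)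
  have "nrm (a i * (?A - ?B)) \<le> m i * (\<epsilon> * ?M)"
    unfolding nrm_mult using insert.prems(1) IH m by (intro mult_mono) (auto simp: nrm_nonneg)
  moreover have "nrm ((a i - b i) * ?B) \<le> (\<epsilon> * m i) * ?M"
    unfolding nrm_mult using insert.prems(3) B m assms(2)
    by (intro mult_mono) (auto simp: nrm_nonneg)
  moreover have "a i * ?A - b i * ?B = a i * (?A - ?B) + (a i - b i) * ?B"
    by (simp add: algebra_simps)
  ultimately show ?case
    using nrm_add_le[of "a i * (?A - ?B)" "(a i - b i) * ?B"] insert.hyps
    by (simp add: mult_ac)
qed

lemma nrm_prod_near_1:
  assumes "\<And>i. i \<in> I \<Longrightarrow> nrm (a i - 1) \<le> \<epsilon>" "0 \<le> \<epsilon>" "\<epsilon> \<le> 1"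
  shows "nrm ((\<Prod>i\<in>I. a i) - 1) \<le> \<epsilon>"
proof (cases "finite I")
  case True
  have "nrm (a i) \<le> 1" if "i \<in> I" for i
    using nrm_add_le[of "a i - 1" 1] assms(1)[OF that] assms(3) by simp
  then show ?thesis
    using nrm_prod_diff_le[OF True assms(2), of a "\<lambda>_. 1" "\<lambda>_. 1"] assms(1) by simp
qed (use assms in simp)

lemma nrm_power_near_1:
  assumes "nrm (x - 1) \<le> \<epsilon>" "\<epsilon> \<le> 1"
  shows "nrm (x ^ n - 1) \<le> \<epsilon>"
  using nrm_prod_near_1[of "{..<n}" "\<lambda>_. x" \<epsilon>] assms nrm_nonneg[of "x - 1"] by simp

lemma nrm_mult_near_1:
  assumes "nrm (x - 1) \<le> \<epsilon>" "nrm (y - 1) \<le> \<epsilon>" "\<epsilon> \<le> 1"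
  shows "nrm (x * y - 1) \<le> \<epsilon>"
  using nrm_prod_near_1[of "UNIV :: bool set" "\<lambda>i. if i then x else y" \<epsilon>] assms
    nrm_nonneg[of "x - 1"] by (simp add: UNIV_bool mult.commute)

lemma nrm_inverse_near_1:
  assumes "nrm (x - 1) \<le> \<epsilon>" "\<epsilon> < 1"
  shows "nrm (inverse x - 1) \<le> \<epsilon>"
proof -
  have 1: "nrm x = 1"
    using assms by (intro nrm_eq_1_of_near_1) simp
  then have "x \<noteq> 0"
    by auto
  then have "inverse x - 1 = (1 - x) / x"
    by (simp add: field_simps)
  then show ?thesis
    using assms 1 by (simp add: nrm_divide nrm_commute)
qed

text \<open>
  The factor \<open>1 + x + \<dots> + x\<^bsup>q-1\<^esup>\<close> of \<open>x\<^bsup>q\<^esup> - 1\<close> is congruent to \<open>q = 0\<close> modulo \<open>x - 1\<close>.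
\<close>
lemma nrm_power_char_near_1:
  assumes "nrm (x - 1) \<le> \<epsilon>" "\<epsilon> \<le> 1" and q: "of_nat q = (0 :: 'k)"
  shows "nrm (x ^ (q ^ k) - 1) \<le> \<epsilon> ^ Suc k"
proof (induction k)
  case 0
  then show ?case using assms by simp
next
  case (Suc k)
  let ?y = "x ^ (q ^ k)"
  have sum_le: "nrm (\<Sum>i\<in>I. g i) \<le> \<epsilon>" if "\<And>i. i \<in> I \<Longrightarrow> nrm (g i) \<le> \<epsilon>" for I and g :: "nat \<Rightarrow> 'k"
    using that
  proof (induction I rule: infinite_finite_induct)
    case (insert i I)
    then show ?case using nrm_add_le[of "g i" "sum g I"] by fastforce
  qed (use assms(1) nrm_nonneg[of "x - 1"] in auto)
  have "(\<Sum>i<q. ?y ^ i) = (\<Sum>i<q. ?y ^ i - 1)"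
    using q by (simp add: sum_subtractf)
  also have "nrm \<dots> \<le> \<epsilon>"
    by (intro sum_le) (metis assms(1,2) nrm_power_near_1 power_mult)
  finally have "nrm ((?y - 1) * (\<Sum>i<q. ?y ^ i)) \<le> \<epsilon> ^ Suc k * \<epsilon>"
    unfolding nrm_mult using Suc nrm_nonneg assms(1) order_trans
    by (intro mult_mono) (auto intro: order_trans[OF nrm_nonneg])
  moreover have "x ^ (q ^ Suc k) - 1 = (?y - 1) * (\<Sum>i<q. ?y ^ i)"
    using power_diff_1_eq[of ?y q] by (simp add: mult.commute flip: power_mult)
  ultimately show ?case
    by (simp add: mult.commute)
qed

end

section \<open>Absolute value, degree and sign of Laurent series in 1/T\<close>

lemma CARD_ge_2: "CARD('a::finite_field) \<ge> 2"
  using card_mono[of "UNIV :: 'a set" "{0, 1}"] by simp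

text \<open>Translation by 1 permutes the field, so the sum of all elements does not change when 1
  is added to each of the q summands.\<close>

lemma of_nat_CARD_eq_0: "of_nat CARD('a::finite_field) = (0 :: 'a)"
proof -
  have "(\<Sum>x\<in>UNIV. x :: 'a) = (\<Sum>x\<in>UNIV. x + 1)"
    by (rule sum.reindex_bij_witness[of _ "\<lambda>x. x + 1" "\<lambda>x. x - 1"]) auto
  then show ?thesis
    by (simp add: sum.distrib)
qed

lemma of_nat_CARD_fls_eq_0: "of_nat CARD('a::finite_field) = (0 :: 'a fls)"
  by (simp add: fls_of_nat of_nat_CARD_eq_0)

lemma abs_inf_0 [simp]: "abs_inf 0 = 0"
  by (simp add: abs_inf_def)

lemma CARD_powi_le_iff: "real CARD('a::finite_field) powi j \<le> real CARD('a) powi k \<longleftrightarrow> j \<le> k"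
proof -
  have q: "1 < real CARD('a)"
    using CARD_ge_2[where 'a = 'a] by simp
  show ?thesis
    using power_int_strict_increasing[OF _ q, of k j] q
    by (cases "j \<le> k") (auto intro!: power_int_increasing simp: not_le)
qed

lemma CARD_powi_pos: "real CARD('a::finite_field) powi k > 0"
  using CARD_ge_2[where 'a = 'a] by (intro zero_less_power_int) simp

lemma abs_inf_le_iff:
  "abs_inf (x :: 'a::finite_field fls) \<le> real CARD('a) powi k \<longleftrightarrow> x = 0 \<or> deg_inf x \<le> k"
  by (simp add: abs_inf_def CARD_powi_le_iff)

lemma abs_inf_less_iff:
  "abs_inf (x :: 'a::finite_field fls) < real CARD('a) powi k \<longleftrightarrow> x = 0 \<or> deg_inf x < k"
  using CARD_ge_2[where 'a = 'a] zero_less_power_int[of "real CARD('a)" k]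
  by (auto simp: abs_inf_def CARD_powi_le_iff simp flip: not_le)

interpretation inf: ultrametric_norm "abs_inf :: 'a::finite_field fls \<Rightarrow> real"
proof
  fix x y :: "'a fls"
  have q: "real CARD('a) > 1" 
    using CARD_ge_2[where 'a = 'a] by simp
  show "0 \<le> abs_inf x" "abs_inf x = 0 \<longleftrightarrow> x = 0"
    by (simp_all add: abs_inf_def)
  show "abs_inf (x * y) = abs_inf x * abs_inf y"
    using q by (auto simp: abs_inf_def deg_inf_def simp flip: power_int_add)
  show "abs_inf (x + y) \<le> max (abs_inf x) (abs_inf y)"
  proof (cases "x = 0 \<or> y = 0 \<or> x + y = 0")
    case True
    then show ?thesis by (auto simp: abs_inf_def le_max_iff_disj)
  next
    case False
    then have "min (fls_subdegree x) (fls_subdegree y) \<le> fls_subdegree (x + y)"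
      by (intro fls_plus_subdegree) auto
    with False show ?thesis
      using q by (auto simp: abs_inf_def deg_inf_def le_max_iff_disj min_le_iff_disj 
        intro: power_int_increasing)
  qed
qed


lemma deg_inf_mult:
  "x \<noteq> 0 \<Longrightarrow> y \<noteq> 0 \<Longrightarrow> deg_inf (x * y) = deg_inf x + deg_inf y"
  by (simp add: deg_inf_def)

lemma sgn_inf_mult: "sgn_inf (x * y) = sgn_inf x * sgn_inf y"
proof (cases "x = 0 \<or> y = 0")
  case False
  then show ?thesis
    by (simp add: sgn_inf_def fls_times_base)
qed (auto simp: sgn_inf_def)

lemma deg_inf_inverse: "deg_inf (inverse x) = - deg_inf x"
  by (cases "x = 0") (simp_all add: deg_inf_def fls_inverse_subdegree)

lemma sgn_inf_eq_0_iff [simp]: "sgn_inf x = 0 \<longleftrightarrow> x = 0"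
  by (simp add: sgn_inf_def nth_fls_subdegree_zero_iff)

lemma deg_inf_const [simp]: "deg_inf (fls_const c) = 0"
  by (simp add: deg_inf_def)

lemma sgn_inf_const [simp]: "sgn_inf (fls_const c) = c"
  by (simp add: sgn_inf_def)

lemma sgn_inf_1 [simp]: "sgn_inf 1 = 1"
  by (simp add: sgn_inf_def)

lemma deg_inf_power: "deg_inf (x ^ n) = int n * deg_inf x"
  by (simp add: deg_inf_def fls_subdegree_pow)

lemma sgn_inf_power: "sgn_inf (x ^ n) = sgn_inf x ^ n"
  by (induction n) (simp_all add: sgn_inf_mult)

lemma deg_inf_powi: "deg_inf (x powi n) = n * deg_inf x"
  by (simp add: deg_inf_def)

lemma sgn_inf_inverse: "sgn_inf (inverse x) = inverse (sgn_inf x)"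
proof (cases "x = 0")
  case False
  then have "sgn_inf x * sgn_inf (inverse x) = 1"
    by (simp flip: sgn_inf_mult)
  then show ?thesis
    by (metis inverse_unique)
qed (simp add: sgn_inf_def)

lemma sgn_inf_powi: "sgn_inf (x powi n) = sgn_inf x powi n"
  by (simp add: power_int_def sgn_inf_power sgn_inf_inverse)

lemma abs_inf_eq: "x \<noteq> 0 \<Longrightarrow> abs_inf (x :: 'a::finite_field fls) = real CARD('a) powi deg_inf x"
  by (simp add: abs_inf_def)

text \<open>Turns a bound into linear conditions on coefficients; 0 needs no separate case, and
  stability under sums and constant multiples becomes evident.\<close>

lemma abs_inf_less_iff_nth:
  "abs_inf (x :: 'a::finite_field fls) < real CARD('a) powi k \<longleftrightarrow> (\<forall>j\<le>- k. fls_nth x j = 0)"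
proof (cases "x = 0")
  case False
  then have "- k < fls_subdegree x \<longleftrightarrow> (\<forall>j\<le>- k. fls_nth x j = 0)"
    by (metis fls_eq0_below_subdegree fls_subdegree_greaterI linorder_not_less
        nth_fls_subdegree_nonzero order_le_less_trans)
  with False show ?thesis
    by (auto simp: abs_inf_less_iff deg_inf_def)
qed (simp add: abs_inf_less_iff)

lemma abs_inf_less_1_iff: "abs_inf x < 1 \<longleftrightarrow> (\<forall>j\<le>0. fls_nth x j = 0)"
  using abs_inf_less_iff_nth[of x 0] by simp

text \<open>Translates between estimates and the multiplicative data \<open>deg_inf\<close> and
  \<open>sgn_inf\<close>; comparisons of degrees and signs below pass through quotients close to
  1.\<close>

lemma abs_inf_near_1_iff:
  "abs_inf (x - 1) < 1 \<longleftrightarrow> x \<noteq> 0 \<and> deg_inf x = 0 \<and> sgn_inf x = 1"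
proof
  assume "abs_inf (x - 1) < 1"
  then have *: "fls_nth x j = (if j = 0 then 1 else 0)" if "j \<le> 0" for j
    using that by (simp add: abs_inf_less_1_iff)
  have "fls_subdegree x = 0"
    using * by (intro fls_subdegree_eqI) auto
  moreover have "x \<noteq> 0"
    using *[of 0] by auto
  ultimately show "x \<noteq> 0 \<and> deg_inf x = 0 \<and> sgn_inf x = 1"
    using *[of 0] by (simp add: deg_inf_def sgn_inf_def)
next
  assume *: "x \<noteq> 0 \<and> deg_inf x = 0 \<and> sgn_inf x = 1"
  then have "fls_nth x j = (if j = 0 then 1 else 0)" if "j \<le> 0" for j
    using that by (auto simp: deg_inf_def sgn_inf_def)
  then show "abs_inf (x - 1) < 1"
    by (auto simp: abs_inf_less_1_iff)
qed

section \<open>Convergence and completeness of Laurent series\<close>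

lemma tendsto_CARD_powi:
  "((\<lambda>n. real CARD('a::finite_field) powi (- int n)) \<longlongrightarrow> 0) sequentially"
  using CARD_ge_2[where 'a = 'a] 
  by (simp add: power_int_minus flip: power_inverse) (rule LIMSEQ_realpow_zero; simp add: field_simps)

lemma CARD_powi_less_ex:
  assumes "e > 0"
  obtains k :: nat where "real CARD('a::finite_field) powi (- int k) < e"
  using order_tendstoD(2)[OF tendsto_CARD_powi[where 'a = 'a] assms]
  by (auto simp: eventually_sequentially)

text \<open>Both distances depend only on the subdegree of the difference: a bound
  \<open>q^(-k)\<close> for \<open>abs_inf\<close> forces subdegree at least \<open>k\<close>, hence
  a bound \<open>2^(-k)\<close> for the metric of the type.\<close>

lemma fls_tendsto_of_abs_inf:
  fixes g :: "'b \<Rightarrow> 'a::finite_field fls"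
  assumes "\<And>e. e > 0 \<Longrightarrow> \<forall>\<^sub>F n in F. abs_inf (g n - l) \<le> e"
  shows "(g \<longlongrightarrow> l) F"
proof (rule tendstoI)
  fix e :: real
  assume "e > 0"
  then obtain k :: nat where k: "inverse (2 ^ k) < e"
    using real_arch_pow_inv[of e "1 / 2"] by (auto simp: power_one_over inverse_eq_divide)
  have dist: "dist (g n) l < e" if "abs_inf (g n - l) \<le> real CARD('a) powi (- int k)" for n
  proof (cases "g n = l")
    case False
    with that have *: "int k \<le> fls_subdegree (g n - l)"
      by (simp add: abs_inf_le_iff deg_inf_def)
    then have "dist (g n) l = inverse (2 ^ nat (fls_subdegree (g n - l)))"
      using False by (simp add: dist_fls_def)
    also have "\<dots> \<le> inverse (2 ^ k)"
      using * by (intro le_imp_inverse_le power_increasing) auto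
    finally show ?thesis using k by simp
  qed (use \<open>e > 0\<close> in simp)
  have "real CARD('a) powi (- int k) > 0"
    using CARD_ge_2[where 'a = 'a] by (intro zero_less_power_int) simp
  from assms[OF this] show "\<forall>\<^sub>F n in F. dist (g n) l < e"
    by eventually_elim (rule dist)
qed

text \<open>Small consecutive differences suffice in an ultrametric: every coefficient is eventually
  constant, and the eventual values form the limit. The bound by 1 excludes coefficients of negative
  index, so the limit is a formal power series.\<close>

lemma fls_complete:
  fixes U :: "nat \<Rightarrow> 'a::finite_field fls"
  assumes le_1: "\<And>n. abs_inf (U n) \<le> 1"
    and step: "\<And>e. e > 0 \<Longrightarrow> \<forall>\<^sub>F n in sequentially. abs_inf (U (Suc n) - U n) \<le> e"
  obtains u where "\<And>e. e > 0 \<Longrightarrow> \<forall>\<^sub>F n in sequentially. abs_inf (U n - u) \<le> e"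
proof -
  have "\<exists>M. \<forall>n\<ge>M. \<forall>j\<le>int k. fls_nth (U n) j = fls_nth (U M) j" for k
  proof -
    have "real CARD('a) powi (- int (Suc k)) > 0"
      using CARD_ge_2[where 'a = 'a] by (intro zero_less_power_int) simp
    from step[OF this] obtain M
      where M: "abs_inf (U (Suc n) - U n) \<le> real CARD('a) powi (- int (Suc k))" if "n \<ge> M" for n
      by (auto simp: eventually_sequentially)
    have "fls_nth (U n) j = fls_nth (U M) j" if "n \<ge> M" "j \<le> int k" for n j
      using that(1)
    proof (induction n rule: dec_induct)
      case (step n)
      have "abs_inf (U (Suc n) - U n) < real CARD('a) powi (- int k)"
        using M[OF step.hyps(1)] CARD_powi_le_iff[of "- int k" "- int (Suc k)", where 'a = 'a]
        by linarith
      with that(2) have "fls_nth (U (Suc n) - U n) j = 0"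
        by (subst (asm) abs_inf_less_iff_nth) simp
      with step.IH show ?case by simp
    qed simp
    then show ?thesis by blast
  qed
  \<comment> \<open>From index \<open>M k\<close> on, all coefficients up to position
    \<open>k\<close> are frozen.\<close>
  then obtain M where M: "\<And>k n j. n \<ge> M k \<Longrightarrow> j \<le> int k \<Longrightarrow> fls_nth (U n) j = fls_nth (U (M k)) j"
    by metis
  define u where "u = fps_to_fls (Abs_fps (\<lambda>k. fls_nth (U (M k)) (int k)))"
  have u: "fls_nth u j = fls_nth (U n) j" if "n \<ge> M k" "j \<le> int k" for n k j
  proof (cases "j < 0")
    case True
    have "abs_inf (U n) < real CARD('a) powi 1"
      using le_1[of n] CARD_ge_2[where 'a = 'a] by simp
    with True have "fls_nth (U n) j = 0"
      unfolding abs_inf_less_iff_nth by simp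
    with True show ?thesis by (simp add: u_def)
  next
    case False
    then have "fls_nth u j = fls_nth (U (M (nat j))) j"
      by (simp add: u_def)
    \<comment> \<open>\<open>M\<close> is not known to be monotone, so the two indices are compared
      through their maximum.\<close>
    also have "\<dots> = fls_nth (U (max n (M (nat j)))) j"
      using False by (intro M[symmetric]) auto
    also have "\<dots> = fls_nth (U (M k)) j"
      using that by (intro M) auto
    also have "\<dots> = fls_nth (U n) j"
      using that by (intro M[symmetric]) auto
    finally show ?thesis .
  qed
  show ?thesis
  proof (rule that)
    fix e :: real
    assume "e > 0"
    then obtain k :: nat where k: "real CARD('a) powi (- int k) < e"
      by (rule CARD_powi_less_ex)
    have "abs_inf (U n - u) < real CARD('a) powi (- int k)" if "n \<ge> M k" for n
      using u[OF that] by (simp add: abs_inf_less_iff_nth)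
    with k show "\<forall>\<^sub>F n in sequentially. abs_inf (U n - u) \<le> e"
      unfolding eventually_sequentially by (meson less_imp_le less_trans)
  qed
qed

section \<open>The polynomial ring inside the Laurent series\<close>

lemma of_A_0 [simp]: "of_A 0 = 0"
  by (simp add: of_A_def)

lemma of_A_pCons: "of_A (pCons c p) = fls_const c + fls_X_inv * of_A p"
  by (simp add: of_A_def map_poly_pCons)

lemma of_A_1 [simp]: "of_A 1 = 1"
  by (simp add: one_pCons of_A_pCons)

lemma of_A_const: "of_A [:c:] = fls_const c"
  by (simp add: of_A_pCons)

lemma of_A_add: "of_A (p + r) = of_A p + of_A r"
  by (induction p r rule: poly_induct2) (simp_all add: of_A_pCons algebra_simps flip: fls_plus_const)

lemma of_A_minus: "of_A (- p) = - of_A p"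
  using of_A_add[of p "- p"] by (simp add: add_eq_0_iff)

lemma of_A_diff: "of_A (p - r) = of_A p - of_A r"
  using of_A_add[of p "- r"] by (simp add: of_A_minus)

lemma of_A_smult: "of_A (Polynomial.smult c p) = fls_const c * of_A p"
  by (induction p) (simp_all add: of_A_pCons algebra_simps)

lemma of_A_mult: "of_A (p * r) = of_A p * of_A r"
  by (induction p) (simp_all add: of_A_pCons of_A_add of_A_smult algebra_simps)

lemma of_A_monom: "of_A (Polynomial.monom c n) = fls_const c * fls_X_inv ^ n"
  by (induction n) (simp_all add: monom_Suc of_A_pCons monom_0)

lemma fls_nth_of_A: "fls_nth (of_A p) j = (if j > 0 then 0 else Polynomial.coeff p (nat (- j)))"
proof (induction p arbitrary: j)
  case (pCons c p)
  have "fls_nth (fls_X_inv * of_A p) j = fls_nth (of_A p) (j + 1)"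
    by (simp add: fls_X_inv_times_conv_shift)
  also have "\<dots> = (if j \<ge> 0 then 0 else Polynomial.coeff p (nat (- j) - 1))"
    by (simp add: pCons.IH nat_diff_distrib')
  finally show ?case
    by (auto simp: of_A_pCons coeff_pCons split: nat.splits)
qed simp

lemma of_A_eq_0_iff [simp]: "of_A p = 0 \<longleftrightarrow> p = 0"
proof
  assume "of_A p = 0"
  then have "Polynomial.coeff p n = 0" for n
    using fls_nth_of_A[of p "- int n"] by (simp split: if_splits)
  then show "p = 0"
    by (simp add: poly_eq_iff)
qed simp

lemma deg_inf_of_A: "deg_inf (of_A p) = int (Polynomial.degree p)"
proof (cases "p = 0")
  case False
  have "fls_subdegree (of_A p) = - int (Polynomial.degree p)"
    using False by (intro fls_subdegree_eqI) (auto simp: fls_nth_of_A coeff_eq_0)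
  then show ?thesis by (simp add: deg_inf_def)
qed (simp add: deg_inf_def)

lemma sgn_inf_of_A: "sgn_inf (of_A p) = Polynomial.lead_coeff p"
proof -
  have "fls_subdegree (of_A p) = - int (Polynomial.degree p)"
    using deg_inf_of_A[of p] by (simp add: deg_inf_def)
  then show ?thesis
    by (simp add: sgn_inf_def fls_nth_of_A)
qed

lemma of_A_abs_less_1: "abs_inf (of_A p) < 1 \<Longrightarrow> p = 0"
  using abs_inf_less_iff[of "of_A p" 0] by (simp add: deg_inf_of_A)

section \<open>Lattices over the finite field\<close>

text \<open>The common properties of the sets \<open>Lambda_eps f \<epsilon>\<close> and of the
  ideals. Note that \<open>deg_inf 0 = 0\<close>. The last assumption, elements in every large
  degree, makes the counting series rational with denominator \<open>1 - q u\<close>.\<close>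

locale fq_lattice =
  fixes \<Lambda> :: "'a::finite_field fls set"
  assumes zero_mem: "0 \<in> \<Lambda>"
    and add_mem: "x \<in> \<Lambda> \<Longrightarrow> y \<in> \<Lambda> \<Longrightarrow> x + y \<in> \<Lambda>"
    and const_mult_mem: "x \<in> \<Lambda> \<Longrightarrow> fls_const c * x \<in> \<Lambda>"
    and deg_nonneg: "x \<in> \<Lambda> \<Longrightarrow> 0 \<le> deg_inf x"
    and finite_deg_less: "finite {x \<in> \<Lambda>. deg_inf x < n}"
    and eventually_deg_slice: "\<forall>\<^sub>F M in sequentially. deg_slice \<Lambda> M \<noteq> {}"
begin

text \<open>The absolute value is used instead of the degree so that 0 lies in every ball, including
  \<open>ball_lt 0\<close>; each ball is then a vector space over the finite field.\<close>

definition ball_lt :: "nat \<Rightarrow> 'a fls set" where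
  "ball_lt M = {x \<in> \<Lambda>. abs_inf x < real CARD('a) powi int M}"

lemma mem_ball_lt_iff: "x \<in> ball_lt M \<longleftrightarrow> x \<in> \<Lambda> \<and> (x = 0 \<or> deg_inf x < int M)"
  unfolding ball_lt_def abs_inf_less_iff by simp

lemma mem_ball_lt_iff_nth: "x \<in> ball_lt M \<longleftrightarrow> x \<in> \<Lambda> \<and> (\<forall>j\<le>- int M. fls_nth x j = 0)"
  unfolding ball_lt_def abs_inf_less_iff_nth by simp

lemma minus_mem: "x \<in> \<Lambda> \<Longrightarrow> - x \<in> \<Lambda>"
  using const_mult_mem[of x "- 1"] by simp

lemma diff_mem: "x \<in> \<Lambda> \<Longrightarrow> y \<in> \<Lambda> \<Longrightarrow> x - y \<in> \<Lambda>"
  using add_mem[of x "- y"] minus_mem[of y] by simp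

lemma finite_ball_lt: "finite (ball_lt M)"
  by (rule finite_subset[of _ "insert 0 {x \<in> \<Lambda>. deg_inf x < int M}"])
    (auto simp: mem_ball_lt_iff finite_deg_less)

lemma ball_lt_0: "ball_lt 0 = {0}"
  using deg_nonneg zero_mem by (fastforce simp: mem_ball_lt_iff)

lemma ball_lt_Suc: "ball_lt (Suc M) = ball_lt M \<union> deg_slice \<Lambda> M"
  using zero_mem by (auto simp: mem_ball_lt_iff deg_slice_def)

lemma ball_lt_inter_slice: "ball_lt M \<inter> deg_slice \<Lambda> M = {}"
  by (auto simp: mem_ball_lt_iff deg_slice_def)

lemma finite_deg_slice: "finite (deg_slice \<Lambda> M)"
  using finite_ball_lt[of "Suc M"] by (simp add: ball_lt_Suc)

lemma ball_lt_closed: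
  "x \<in> ball_lt M \<Longrightarrow> y \<in> ball_lt M \<Longrightarrow> x + y \<in> ball_lt M"
  "x \<in> ball_lt M \<Longrightarrow> y \<in> ball_lt M \<Longrightarrow> x - y \<in> ball_lt M"
  "x \<in> ball_lt M \<Longrightarrow> fls_const c * x \<in> ball_lt M"
  by (auto simp: mem_ball_lt_iff_nth add_mem diff_mem const_mult_mem)

lemma card_deg_slice: "card (ball_lt (Suc M)) = card (ball_lt M) + card (deg_slice \<Lambda> M)"
  unfolding ball_lt_Suc
  by (intro card_Un_disjoint finite_ball_lt finite_deg_slice ball_lt_inter_slice)

text \<open>An element \<open>e\<close> of degree \<open>M\<close> spans a complement of
  \<open>ball_lt M\<close> in \<open>ball_lt (Suc M)\<close>: exactly one constant multiple of
  \<open>e\<close> cancels the coefficient at \<open>T^M\<close>, which has index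
  \<open>- int M\<close>.\<close>

lemma card_ball_lt_Suc:
  assumes "deg_slice \<Lambda> M \<noteq> {}"
  shows "card (ball_lt (Suc M)) = CARD('a) * card (ball_lt M)"
proof -
  obtain e where e: "e \<in> \<Lambda>" "e \<noteq> 0" "deg_inf e = int M"
    using assms by (auto simp: deg_slice_def)
  then have sub: "fls_subdegree e = - int M"
    by (simp add: deg_inf_def)
  then have lead: "fls_nth e (- int M) \<noteq> 0"
    using e(2) by (metis nth_fls_subdegree_nonzero)
  have below: "fls_nth e j = 0" if "j < - int M" for j
    using that sub by simp
  have "inj_on (\<lambda>(c, w). fls_const c * e + w) (UNIV \<times> ball_lt M)"
  proof (rule inj_onI, clarify)
    fix c c' w w'
    assume w: "w \<in> ball_lt M" "w' \<in> ball_lt M"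
      and eq: "fls_const c * e + w = fls_const c' * e + w'"
    have "fls_nth (fls_const c * e + w) (- int M) = fls_nth (fls_const c' * e + w') (- int M)"
      using eq by simp
    with w lead have "c = c'"
      by (simp add: mem_ball_lt_iff_nth)
    with eq show "c = c' \<and> w = w'"
      by simp
  qed
  moreover have "(\<lambda>(c, w). fls_const c * e + w) ` (UNIV \<times> ball_lt M) = ball_lt (Suc M)"
  proof (intro equalityI subsetI)
    fix x assume x: "x \<in> ball_lt (Suc M)"
    define c where "c = fls_nth x (- int M) / fls_nth e (- int M)"
    have "fls_nth (x - fls_const c * e) j = 0" if "j \<le> - int M" for j
      using x that lead below[of j] by (cases "j = - int M") (auto simp: mem_ball_lt_iff_nth c_def)
    then have "x - fls_const c * e \<in> ball_lt M"
      using x e(1) by (simp add: mem_ball_lt_iff_nth diff_mem const_mult_mem)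
    then show "x \<in> (\<lambda>(c, w). fls_const c * e + w) ` (UNIV \<times> ball_lt M)"
      by (intro image_eqI[of _ _ "(c, x - fls_const c * e)"]) auto
  next
    fix x assume "x \<in> (\<lambda>(c, w). fls_const c * e + w) ` (UNIV \<times> ball_lt M)"
    then show "x \<in> ball_lt (Suc M)"
      using e(1) below by (auto simp: mem_ball_lt_iff_nth add_mem const_mult_mem)
  qed
  ultimately have "card (ball_lt (Suc M)) = card (UNIV \<times> ball_lt M :: ('a \<times> 'a fls) set)"
    by (metis card_image)
  then show ?thesis
    by (simp add: card_cartesian_product)
qed

lemma card_ball_lt_power: "\<exists>k. card (ball_lt M) = CARD('a) ^ k"
proof (induction M)
  case (Suc M)
  then obtain k where k: "card (ball_lt M) = CARD('a) ^ k" ..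
  show ?case
  proof (cases "deg_slice \<Lambda> M = {}")
    case True
    with k show ?thesis by (auto simp: card_deg_slice)
  next
    case False
    with k show ?thesis by (metis card_ball_lt_Suc power_Suc)
  qed
qed (auto simp: ball_lt_0 intro: exI[of _ 0])

text \<open>Once every degree is occupied, each step multiplies the cardinality by q, so the
  exponent grows without bound.\<close>

lemma eventually_card_ball_lt_ge: "\<forall>\<^sub>F M in sequentially. \<exists>k\<ge>n. card (ball_lt M) = CARD('a) ^ k"
proof -
  obtain M0 where M0: "\<And>M. M \<ge> M0 \<Longrightarrow> deg_slice \<Lambda> M \<noteq> {}"
    using eventually_deg_slice by (auto simp: eventually_sequentially)
  have "\<exists>k\<ge>M - M0. card (ball_lt M) = CARD('a) ^ k" if "M \<ge> M0" for M
    using that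
  proof (induction M rule: dec_induct)
    case base
    then show ?case using card_ball_lt_power[of M0] by simp
  next
    case (step M)
    then obtain k where "k \<ge> M - M0" "card (ball_lt M) = CARD('a) ^ k"
      by auto
    then show ?case
      using M0[OF step.hyps(1)] by (intro exI[of _ "Suc k"]) (auto simp: card_ball_lt_Suc)
  qed
  then show ?thesis
    unfolding eventually_sequentially
    by (metis le_add_diff_inverse2 le_add2 add_le_imp_le_diff le_trans le_add1)
qed

section \<open>The counting series and the exponent t\<close>

text \<open>The slices eventually grow by the factor q, so multiplication by \<open>1 - q u\<close>
  leaves a polynomial \<open>P\<close> with integer coefficients. The value
  \<open>P(1) = q - 1\<close> amounts to \<open>Z(1) = -1\<close>.\<close>

lemma Z_series_rational:
  obtains P :: "real poly" and D :: int where
    "Z_series \<Lambda> * fps_of_poly [:1, - real CARD('a):] = fps_of_poly P"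
    "poly P 1 = real CARD('a) - 1" "poly (pderiv P) 1 = of_int D"
proof -
  obtain M0 where M0: "\<And>M. M \<ge> M0 \<Longrightarrow> deg_slice \<Lambda> M \<noteq> {}"
    using eventually_deg_slice by (auto simp: eventually_sequentially)
  let ?q = "real CARD('a)"
  define s where "s n = real (card (deg_slice \<Lambda> n))" for n
  define b where "b n = real (card (ball_lt n))" for n
  define p where "p n = (case n of 0 \<Rightarrow> s 0 | Suc m \<Rightarrow> s (Suc m) - ?q * s m)" for n
  define P where "P = (\<Sum>n\<le>M0. Polynomial.monom (p n) n)"
  have s: "s n = b (Suc n) - b n" for n
    by (simp add: s_def b_def card_deg_slice)
  have b: "b (Suc n) = ?q * b n" if "n \<ge> M0" for n
    using card_ball_lt_Suc[OF M0[OF that]] by (simp add: b_def)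
  have b0: "b 0 = 1"
    by (simp add: b_def ball_lt_0)
  have "p n = 0" if n: "n > M0" for n
  proof -
    obtain m where m: "n = Suc m" "m \<ge> M0"
      using n by (cases n) auto
    then have "b (Suc n) = ?q * b n" "b n = ?q * b m"
      using b[of n] b[of m] n by auto
    with m show ?thesis
      by (simp add: p_def s algebra_simps)
  qed
  then have coeff_P: "Polynomial.coeff P n = p n" for n
    by (cases "n \<le> M0") (auto simp: P_def coeff_sum if_distrib sum.delta)
  have "Z_series \<Lambda> * fps_of_poly [:1, - ?q:] = fps_of_poly P"
  proof (rule fps_ext)
    fix n
    have "Z_series \<Lambda> * fps_of_poly [:1, - ?q:] = Z_series \<Lambda> - fps_const ?q * (fps_X * Z_series \<Lambda>)"
      by (simp add: fps_of_poly_pCons algebra_simps flip: fps_const_neg)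
    then show "fps_nth (Z_series \<Lambda> * fps_of_poly [:1, - ?q:]) n = fps_nth (fps_of_poly P) n"
      by (simp add: coeff_P p_def Z_series_def s_def split: nat.splits)
  qed
  \<comment> \<open>The partial sums telescope; at \<open>m = M0\<close> the terms
    \<open>b (Suc m)\<close> and \<open>q * b m\<close> cancel and leave
    \<open>q - 1\<close>.\<close>
  moreover have "(\<Sum>n\<le>m. p n) = b (Suc m) - 1 - ?q * (b m - 1)" for m
    by (induction m) (simp_all add: p_def s b0 algebra_simps)
  from this[of M0] b[of M0] have "poly P 1 = ?q - 1"
    by (simp add: P_def poly_sum poly_monom algebra_simps)
  moreover have "p n \<in> \<int>" for n
    by (auto simp: p_def s_def split: nat.splits)
  then have "poly (pderiv P) 1 \<in> \<int>"
    by (auto simp: poly_altdef coeff_pderiv coeff_P intro!: Ints_sum Ints_mult)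
  ultimately show ?thesis
    using that by (auto elim!: Ints_cases)
qed

end

text \<open>Any two fractions with the same expansion at 0 agree after cross-multiplication, hence
  near 1 where neither denominator vanishes, and so have the same derivative there. The quotient
  rule gives the derivative \<open>(q - D) / (q - 1)\<close>.\<close>

lemma t_exp_eqI:
  fixes \<Lambda> :: "'a::finite_field fls set"
  assumes Z: "Z_series \<Lambda> * fps_of_poly [:1, - real CARD('a):] = fps_of_poly P"
    and P1: "poly P 1 = real CARD('a) - 1" and D: "poly (pderiv P) 1 = of_int D"
  shows "t_exp \<Lambda> = int CARD('a) - D"
proof -
  let ?q = "real CARD('a)"
  let ?Q = "[:1, - ?q:]"
  have q: "?q > 1"
    using CARD_ge_2[where 'a = 'a] by simp
  have "((\<lambda>u. poly P u / poly ?Q u) has_field_derivative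
      (of_int D * (1 - ?q) - (?q - 1) * (- ?q)) / (1 - ?q)\<^sup>2) (at 1)"
    using q by (auto intro!: derivative_eq_intros poly_DERIV simp: D P1 pderiv_pCons power2_eq_square)
  moreover have "(of_int D * (1 - ?q) - (?q - 1) * (- ?q)) / (1 - ?q)\<^sup>2 = (?q - D) / (?q - 1)"
    using q by (simp add: power2_eq_square divide_simps) (simp add: algebra_simps)
  ultimately have deriv: "deriv (\<lambda>u. poly P u / poly ?Q u) 1 = (?q - D) / (?q - 1)"
    by (metis DERIV_imp_deriv)
  show ?thesis
    unfolding t_exp_def
  proof (rule the_equality)
    show "\<exists>P Q. poly Q 1 \<noteq> 0 \<and> Z_series \<Lambda> * fps_of_poly Q = fps_of_poly P \<and>
      real_of_int (int CARD('a) - D) = (?q - 1) * deriv (\<lambda>u. poly P u / poly Q u) 1"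
      using q Z deriv by (intro exI[of _ P] exI[of _ ?Q]) (simp add: field_simps)
  next
    fix t
    assume "\<exists>P Q. poly Q 1 \<noteq> 0 \<and> Z_series \<Lambda> * fps_of_poly Q = fps_of_poly P \<and>
      real_of_int t = (?q - 1) * deriv (\<lambda>u. poly P u / poly Q u) 1"
    then obtain P' Q' where Q': "poly Q' 1 \<noteq> 0" and Z': "Z_series \<Lambda> * fps_of_poly Q' = fps_of_poly P'"
      and t: "real_of_int t = (?q - 1) * deriv (\<lambda>u. poly P' u / poly Q' u) 1"
      by blast
    have "fps_of_poly (P' * ?Q) = (Z_series \<Lambda> * fps_of_poly Q') * fps_of_poly ?Q"
      by (simp add: fps_of_poly_mult Z')
    also have "\<dots> = (Z_series \<Lambda> * fps_of_poly ?Q) * fps_of_poly Q'"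
      by (simp add: mult_ac)
    also have "\<dots> = fps_of_poly (P * Q')"
      by (simp add: fps_of_poly_mult Z)
    finally have eq: "P' * ?Q = P * Q'"
      by (simp add: fps_of_poly_eq_iff)
    have "\<forall>\<^sub>F u in nhds 1. poly R u \<noteq> 0" if "poly R 1 \<noteq> 0" for R :: "real poly"
      using that
      using poly_isCont[of 1 R]
      by (intro tendsto_imp_eventually_ne[of "poly R" "poly R 1"])
        (simp_all add: continuous_at tendsto_at_iff_tendsto_nhds)
    from this[OF Q'] this[of ?Q] q
    have "\<forall>\<^sub>F u in nhds 1. poly Q' u \<noteq> 0" "\<forall>\<^sub>F u in nhds 1. poly ?Q u \<noteq> 0"
      by auto
    then have "\<forall>\<^sub>F u in nhds 1. poly P' u / poly Q' u = poly P u / poly ?Q u"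
    proof eventually_elim
      case (elim u)
      have "poly (P' * ?Q) u = poly (P * Q') u"
        by (simp only: eq)
      with elim show ?case
        unfolding poly_mult by (simp add: frac_eq_eq del: poly_pCons)
    qed
    then have "deriv (\<lambda>u. poly P' u / poly Q' u) 1 = deriv (\<lambda>u. poly P u / poly ?Q u) 1"
      by (intro deriv_cong_ev) auto
    with t q have "real_of_int t = real_of_int (int CARD('a) - D)"
      unfolding deriv by simp
    then show "t = int CARD('a) - D"
      by linarith
  qed
qed

text \<open>The counting series is multiplied by \<open>u^s\<close>, which changes the derivative at
  1 by \<open>s * Z(1) = - s\<close>.\<close>

lemma (in fq_lattice) t_exp_shift:
  fixes \<Lambda>' :: "'a fls set"
  assumes "\<And>n. card (deg_slice \<Lambda>' (n + s)) = card (deg_slice \<Lambda> n)"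
    and "\<And>n. n < s \<Longrightarrow> deg_slice \<Lambda>' n = {}"
  shows "t_exp \<Lambda>' = t_exp \<Lambda> - int s * (int CARD('a) - 1)"
proof -
  obtain P D where P: "Z_series \<Lambda> * fps_of_poly [:1, - real CARD('a):] = fps_of_poly P"
    "poly P 1 = real CARD('a) - 1" "poly (pderiv P) 1 = of_int D"
    by (rule Z_series_rational)
  have "Z_series \<Lambda>' = fps_X ^ s * Z_series \<Lambda>"
  proof (rule fps_ext)
    fix n
    show "fps_nth (Z_series \<Lambda>') n = fps_nth (fps_X ^ s * Z_series \<Lambda>) n"
      using assms(1)[of "n - s"] assms(2)[of n] by (auto simp: Z_series_def fps_X_power_mult_nth)
  qed
  then have "Z_series \<Lambda>' * fps_of_poly [:1, - real CARD('a):] =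
      fps_of_poly (Polynomial.monom 1 s * P)"
    by (simp add: fps_of_poly_mult fps_of_poly_monom' P(1) mult.assoc)
  moreover have "poly (Polynomial.monom 1 s * P) 1 = real CARD('a) - 1"
    by (simp add: poly_monom P)
  moreover have "poly (pderiv (Polynomial.monom 1 s * P)) 1 =
      of_int (D + int s * (int CARD('a) - 1))"
    by (simp add: pderiv_mult pderiv_monom poly_monom P)
  ultimately have "t_exp \<Lambda>' = int CARD('a) - (D + int s * (int CARD('a) - 1))"
    by (rule t_exp_eqI)
  with t_exp_eqI[OF P] show ?thesis
    by simp
qed


section \<open>One-units and the convergence of their products\<close>

locale uniformizer =
  fixes \<pi> :: "'a::finite_field fls"
  assumes deg_uniformizer: "deg_inf \<pi> = - 1" and sgn_uniformizer: "sgn_inf \<pi> = 1"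
begin

lemma uniformizer_nonzero: "\<pi> \<noteq> 0"
  using deg_uniformizer by (auto simp: deg_inf_def)

text \<open>The normalised element has degree 0 and sign 1. As absolute values are powers of q, a
  distance below 1 is already at most \<open>1/q\<close>.\<close>

lemma one_unit_near_1:
  assumes "x \<noteq> 0"
  shows "abs_inf (one_unit \<pi> x - 1) \<le> inverse (real CARD('a))"
proof -
  have "abs_inf (one_unit \<pi> x - 1) < 1"
    unfolding abs_inf_near_1_iff using assms uniformizer_nonzero
    by (simp add: one_unit_def divide_inverse deg_inf_mult sgn_inf_mult deg_inf_inverse
        sgn_inf_inverse deg_inf_powi sgn_inf_powi deg_uniformizer sgn_uniformizer)
  then have "one_unit \<pi> x - 1 = 0 \<or> deg_inf (one_unit \<pi> x - 1) \<le> - 1"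
    using abs_inf_less_iff[of "one_unit \<pi> x - 1" 0] by auto
  then have "abs_inf (one_unit \<pi> x - 1) \<le> real CARD('a) powi (- 1)"
    unfolding abs_inf_le_iff .
  then show ?thesis
    by (simp add: power_int_minus)
qed

end

definition u_partial :: "'a::finite_field fls \<Rightarrow> 'a fls set \<Rightarrow> nat \<Rightarrow> 'a fls" where
  "u_partial \<pi> \<Lambda> M = (\<Prod>x | x \<in> \<Lambda> \<and> x \<noteq> 0 \<and> deg_inf x \<le> int M. one_unit \<pi> x)"

locale fq_lattice_uniformizer = fq_lattice \<Lambda> + uniformizer \<pi>
  for \<Lambda> :: "'a::finite_field fls set" and \<pi> :: "'a fls"
begin

text \<open>
  Modulo a small error, the elements \<open>x + w\<close> of a coset of the finite group \<open>ball_lt K\<close> share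
  one one-unit, and a one-unit raised to the order \<open>q\<^bsup>k\<^esup>\<close> of that group is close to \<open>1\<close>.
\<close>
lemma prod_coset_near_1:
  assumes K: "card (ball_lt K) = CARD('a) ^ k"
    and x: "x \<in> deg_slice \<Lambda> (K + n)"
    and \<epsilon>: "real CARD('a) powi (- int n) \<le> \<epsilon>" "real CARD('a) powi (- int k) \<le> \<epsilon>" "\<epsilon> \<le> 1"
  shows "abs_inf ((\<Prod>w\<in>ball_lt K. one_unit \<pi> (x + w)) - 1) \<le> \<epsilon>"
proof -
  have x0: "x \<noteq> 0" "deg_inf x = int (K + n)"
    using x by (auto simp: deg_slice_def)
  have w: "abs_inf ((1 + w / x) - 1) \<le> \<epsilon>" "one_unit \<pi> (x + w) = one_unit \<pi> x * (1 + w / x)"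
    if "w \<in> ball_lt K" for w
  proof -
    have "w = 0 \<or> w / x = 0 \<or> deg_inf (w / x) < - int n"
      using that x0
      by (cases "w = 0") (auto simp: mem_ball_lt_iff divide_inverse deg_inf_mult deg_inf_inverse)
    then have lt: "abs_inf (w / x) < real CARD('a) powi (- int n)"
      unfolding abs_inf_less_iff using x0 by auto
    then show "abs_inf ((1 + w / x) - 1) \<le> \<epsilon>"
      using \<epsilon> by simp
    have "abs_inf ((1 + w / x) - 1) < 1"
      using lt \<epsilon> by simp
    then have u: "1 + w / x \<noteq> 0" "deg_inf (1 + w / x) = 0" "sgn_inf (1 + w / x) = 1"
      unfolding abs_inf_near_1_iff by auto
    have "x + w = x * (1 + w / x)"
      using x0 by (simp add: field_simps)
    then show "one_unit \<pi> (x + w) = one_unit \<pi> x * (1 + w / x)"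
      using u x0 by (simp add: one_unit_def deg_inf_mult sgn_inf_mult)
  qed
  have q: "real CARD('a) \<ge> 1" "inverse (real CARD('a)) \<le> 1"
    using CARD_ge_2[where 'a = 'a] by (auto simp: field_simps)
  have "abs_inf (one_unit \<pi> x ^ (CARD('a) ^ k) - 1) \<le> inverse (real CARD('a)) ^ Suc k"
    using one_unit_near_1[OF x0(1)] q of_nat_CARD_fls_eq_0 by (intro inf.nrm_power_char_near_1)
  also have "\<dots> \<le> inverse (real CARD('a)) ^ k"
    using q by (intro power_decreasing) auto
  also have "\<dots> \<le> \<epsilon>"
    using \<epsilon>(2) by (simp add: power_int_minus power_inverse)
  finally have "abs_inf (one_unit \<pi> x ^ (CARD('a) ^ k) - 1) \<le> \<epsilon>" .
  moreover have "0 \<le> \<epsilon>"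
    using \<epsilon>(1) by (meson of_nat_0_le_iff order_trans zero_le_power_int)
  then have "abs_inf ((\<Prod>w\<in>ball_lt K. 1 + w / x) - 1) \<le> \<epsilon>"
    using w(1) \<epsilon>(3) by (intro inf.nrm_prod_near_1)
  ultimately have "abs_inf (one_unit \<pi> x ^ (CARD('a) ^ k) * (\<Prod>w\<in>ball_lt K. 1 + w / x) - 1) \<le> \<epsilon>"
    using \<epsilon>(3) by (intro inf.nrm_mult_near_1)
  then show ?thesis
    by (simp add: w(2) prod.distrib K)
qed

text \<open>Adding an element of \<open>ball_lt K\<close> changes neither nonvanishing nor degree in
  the slice, so the slice is a disjoint union of cosets, and \<open>prod_coset_near_1\<close>
  applies to each of them.\<close>

lemma prod_deg_slice_near_1:
  assumes "card (ball_lt K) = CARD('a) ^ k"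
    and "real CARD('a) powi (- int n) \<le> \<epsilon>" "real CARD('a) powi (- int k) \<le> \<epsilon>" "\<epsilon> \<le> 1"
  shows "abs_inf ((\<Prod>x\<in>deg_slice \<Lambda> (K + n). one_unit \<pi> x) - 1) \<le> \<epsilon>"
proof -
  let ?S = "deg_slice \<Lambda> (K + n)"
  define coset where "coset x = (\<lambda>w. x + w) ` ball_lt K" for x
  have zero: "0 \<in> ball_lt K"
    by (simp add: mem_ball_lt_iff zero_mem)
  have coset_sub: "coset x \<subseteq> ?S" if "x \<in> ?S" for x
  proof
    fix y
    assume "y \<in> coset x"
    then obtain w where w: "w \<in> ball_lt K" "y = x + w"
      by (auto simp: coset_def)
    have x: "x \<in> \<Lambda>" "x \<noteq> 0" "deg_inf x = int (K + n)"
      using that by (auto simp: deg_slice_def)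
    have "abs_inf w < real CARD('a) powi int (K + n)"
      unfolding abs_inf_less_iff using w(1) by (auto simp: mem_ball_lt_iff)
    then have "abs_inf w < abs_inf x"
      using x by (simp add: abs_inf_eq)
    then have "abs_inf y = abs_inf x"
      unfolding w(2) by (rule inf.nrm_add_eq)
    then have "y \<noteq> 0" "deg_inf y = deg_inf x"
      using x CARD_powi_le_iff[where 'a = 'a, of "deg_inf x" "deg_inf y"]
        CARD_powi_le_iff[where 'a = 'a, of "deg_inf y" "deg_inf x"]
      by (auto simp: abs_inf_def split: if_splits)
    with x w show "y \<in> ?S"
      by (auto simp: deg_slice_def mem_ball_lt_iff intro: add_mem)
  qed
  have coset_eq: "coset y = coset x" if y: "y \<in> coset x" for x y
  proof -
    obtain w where w: "w \<in> ball_lt K" "y = x + w"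
      using y by (auto simp: coset_def)
    show ?thesis
    proof (intro equalityI subsetI)
      fix z assume "z \<in> coset y"
      then obtain v where "v \<in> ball_lt K" "z = x + (w + v)"
        using w by (auto simp: coset_def add_ac)
      with w show "z \<in> coset x"
        unfolding coset_def by (intro image_eqI[of _ _ "w + v"]) (auto intro: ball_lt_closed)
    next
      fix z assume "z \<in> coset x"
      then obtain v where "v \<in> ball_lt K" "z = y + (v - w)"
        using w by (auto simp: coset_def)
      with w show "z \<in> coset y"
        unfolding coset_def by (intro image_eqI[of _ _ "v - w"]) (auto intro: ball_lt_closed)
    qed
  qed
  have mem: "x \<in> coset x" for x
    using zero by (auto simp: coset_def intro: image_eqI[of _ _ 0])
  have fibre: "{y \<in> ?S. coset y = coset x} = coset x" if "x \<in> ?S" for x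
    using coset_sub[OF that] coset_eq mem by blast
  have eq: "(\<Prod>x\<in>?S. one_unit \<pi> x) =
      (\<Prod>C\<in>coset ` ?S. \<Prod>x\<in>{y \<in> ?S. coset y = C}. one_unit \<pi> x)"
    by (rule prod.group[symmetric]) (auto simp: finite_deg_slice)
  have near: "abs_inf ((\<Prod>x\<in>{y \<in> ?S. coset y = C}. one_unit \<pi> x) - 1) \<le> \<epsilon>"
    if C: "C \<in> coset ` ?S" for C
  proof -
    obtain x where x: "x \<in> ?S" "C = coset x"
      using C by blast
    have "(\<Prod>x\<in>{y \<in> ?S. coset y = C}. one_unit \<pi> x) = (\<Prod>w\<in>ball_lt K. one_unit \<pi> (x + w))"
      unfolding x(2) fibre[OF x(1)] unfolding coset_def by (subst prod.reindex) auto
    with prod_coset_near_1[OF assms(1) x(1) assms(2-4)] show ?thesis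
      by simp
  qed
  have "0 \<le> \<epsilon>"
    using assms(2) by (meson of_nat_0_le_iff order_trans zero_le_power_int)
  then show ?thesis
    unfolding eq using near assms(4) by (intro inf.nrm_prod_near_1[where a = "\<lambda>C. \<Prod>x\<in>{y \<in> ?S. coset y = C}. one_unit \<pi> x"])
qed

lemma u_partial_conv_ball_lt: "u_partial \<pi> \<Lambda> M = (\<Prod>x\<in>ball_lt (Suc M) - {0}. one_unit \<pi> x)"
  unfolding u_partial_def by (rule prod.cong) (auto simp: mem_ball_lt_iff)

lemma u_partial_Suc:
  "u_partial \<pi> \<Lambda> (Suc M) = u_partial \<pi> \<Lambda> M * (\<Prod>x\<in>deg_slice \<Lambda> (Suc M). one_unit \<pi> x)"
proof -
  have "ball_lt (Suc (Suc M)) - {0} = (ball_lt (Suc M) - {0}) \<union> deg_slice \<Lambda> (Suc M)"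
    by (subst ball_lt_Suc) (auto simp: deg_slice_def)
  then show ?thesis
    unfolding u_partial_conv_ball_lt using ball_lt_inter_slice[of "Suc M"]
    by (simp only:) (intro prod.union_disjoint, auto simp: finite_ball_lt finite_deg_slice)
qed

lemma abs_inf_u_partial: "abs_inf (u_partial \<pi> \<Lambda> M) = 1"
proof -
  have "abs_inf (one_unit \<pi> x) = 1" if "x \<noteq> 0" for x
    using order.strict_trans1[OF one_unit_near_1[OF that], of 1] CARD_ge_2[where 'a = 'a]
    by (intro inf.nrm_eq_1_of_near_1) (simp add: field_simps)
  then show ?thesis
    by (simp add: u_partial_conv_ball_lt inf.nrm_prod)
qed

text \<open>Consecutive partial products differ by the factor of one slice, which tends to 1 by
  \<open>prod_deg_slice_near_1\<close>; completeness then provides the limit.\<close>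

lemma u_partial_converges:
  assumes "e > 0"
  shows "\<forall>\<^sub>F M in sequentially. abs_inf (u_partial \<pi> \<Lambda> M - u_lim \<pi> \<Lambda>) \<le> e"
proof -
  have "\<forall>\<^sub>F M in sequentially. abs_inf (u_partial \<pi> \<Lambda> (Suc M) - u_partial \<pi> \<Lambda> M) \<le> e"
    if "e > 0" for e
  proof -
    define \<epsilon> where "\<epsilon> = min e 1"
    then obtain n :: nat where n: "real CARD('a) powi (- int n) < \<epsilon>"
      using \<open>e > 0\<close> CARD_powi_less_ex[of \<epsilon>, where 'a = 'a] by auto
    \<comment> \<open>The two errors for a slice are \<open>q^(-k)\<close>, from the order of
      \<open>ball_lt K\<close>, and one from the gap between \<open>K\<close> and the degree of the
      slice. With \<open>k \<ge> n\<close> and a gap of at least \<open>n\<close> both are below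
      \<epsilon>.\<close>
    obtain K k where K: "k \<ge> n" "card (ball_lt K) = CARD('a) ^ k"
      using eventually_card_ball_lt_ge[of n] by (auto simp: eventually_sequentially)
    have "abs_inf (u_partial \<pi> \<Lambda> (Suc M) - u_partial \<pi> \<Lambda> M) \<le> e" if "M \<ge> K + n" for M
    proof -
      let ?p = "\<Prod>x\<in>deg_slice \<Lambda> (Suc M). one_unit \<pi> x"
      have mono: "real CARD('a) powi (- int m) \<le> \<epsilon>" if "m \<ge> n" for m
        using n CARD_powi_le_iff[of "- int m" "- int n", where 'a = 'a] that by linarith
      have "abs_inf ((\<Prod>x\<in>deg_slice \<Lambda> (K + (Suc M - K)). one_unit \<pi> x) - 1) \<le> \<epsilon>"
        using K mono[of k] mono[of "Suc M - K"] that
        by (intro prod_deg_slice_near_1[of K k]) (simp_all add: \<epsilon>_def)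
      then have "abs_inf (?p - 1) \<le> e"
        using that by (simp add: \<epsilon>_def)
      moreover have "u_partial \<pi> \<Lambda> (Suc M) - u_partial \<pi> \<Lambda> M = u_partial \<pi> \<Lambda> M * (?p - 1)"
        by (simp add: u_partial_Suc algebra_simps)
      ultimately show ?thesis
        by (simp add: inf.nrm_mult abs_inf_u_partial)
    qed
    then show ?thesis
      by (auto simp: eventually_sequentially)
  qed
  then obtain u where u: "\<And>e. e > 0 \<Longrightarrow> \<forall>\<^sub>F M in sequentially. abs_inf (u_partial \<pi> \<Lambda> M - u) \<le> e"
    using fls_complete[of "u_partial \<pi> \<Lambda>"] by (auto simp: abs_inf_u_partial)
  then have "u_partial \<pi> \<Lambda> \<longlonglongrightarrow> u"
    by (rule fls_tendsto_of_abs_inf)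
  then have "u_lim \<pi> \<Lambda> = u"
    unfolding u_lim_def u_partial_def[symmetric, abs_def] by (rule limI)
  with u[OF assms] show ?thesis
    by simp
qed

lemma abs_inf_u_lim: "abs_inf (u_lim \<pi> \<Lambda>) = 1"
proof -
  have "\<forall>\<^sub>F M in sequentially. abs_inf (u_partial \<pi> \<Lambda> M - u_lim \<pi> \<Lambda>) \<le> 1 / 2"
    by (rule u_partial_converges) simp
  then obtain M where "abs_inf (u_partial \<pi> \<Lambda> M - u_lim \<pi> \<Lambda>) \<le> 1 / 2"
    by (auto simp: eventually_sequentially)
  then show ?thesis
    using inf.nrm_diff_eq[of "u_partial \<pi> \<Lambda> M - u_lim \<pi> \<Lambda>" "u_partial \<pi> \<Lambda> M"]
    by (simp add: abs_inf_u_partial)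
qed

end

section \<open>Perturbation of lattices\<close>

text \<open>The situation in which two lattices are compared: \<phi> is multiplication by
  \<open>g\<close> up to a relative error \<epsilon>, uniformly on \<Lambda>. It is applied to an
  ideal as \<Lambda> and a set \<open>Lambda_eps f\<close> as \<Lambda>'.\<close>

locale perturbation = fq_lattice_uniformizer \<Lambda> \<pi> + image: fq_lattice_uniformizer \<Lambda>' \<pi>
  for \<Lambda> \<Lambda>' :: "'a::finite_field fls set" and \<pi> :: "'a fls" +
  fixes \<phi> :: "'a fls \<Rightarrow> 'a fls" and g :: "'a fls" and s :: nat and \<epsilon> :: real
  assumes bij: "bij_betw \<phi> \<Lambda> \<Lambda>'"
    and map_0: "\<phi> 0 = 0"
    and scale_nonzero: "g \<noteq> 0" and deg_scale: "deg_inf g = int s" and sgn_scale: "sgn_inf g = 1"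
    and eps: "0 < \<epsilon>" "\<epsilon> < 1"
    and near: "x \<in> \<Lambda> \<Longrightarrow> x \<noteq> 0 \<Longrightarrow> abs_inf (\<phi> x / (g * x) - 1) \<le> \<epsilon>"
begin

text \<open>The relative error factor; the value 1 at 0 is a default that keeps
  \<open>map_eq\<close> and \<open>\<rho>_near_1\<close> valid there.\<close>

definition \<rho> :: "'a fls \<Rightarrow> 'a fls" where
  "\<rho> x = (if x = 0 then 1 else \<phi> x / (g * x))"

lemma \<rho>_near_1: "x \<in> \<Lambda> \<Longrightarrow> abs_inf (\<rho> x - 1) \<le> \<epsilon>"
  using near[of x] eps by (simp add: \<rho>_def)

lemma map_eq: "\<phi> x = g * x * \<rho> x"
  by (simp add: \<rho>_def map_0 scale_nonzero)

lemma \<rho>_unit: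
  assumes "x \<in> \<Lambda>"
  shows "\<rho> x \<noteq> 0" "deg_inf (\<rho> x) = 0" "sgn_inf (\<rho> x) = 1"
  using order.strict_trans1[OF \<rho>_near_1[OF assms] eps(2)] unfolding abs_inf_near_1_iff by auto

lemma map_props:
  assumes "x \<in> \<Lambda>" "x \<noteq> 0"
  shows "\<phi> x \<noteq> 0" "deg_inf (\<phi> x) = deg_inf x + int s" "sgn_inf (\<phi> x) = sgn_inf x"
  using assms \<rho>_unit[OF assms(1)] scale_nonzero
  by (simp_all add: map_eq deg_inf_mult sgn_inf_mult deg_scale sgn_scale)

lemma map_eq_0_iff: "x \<in> \<Lambda> \<Longrightarrow> \<phi> x = 0 \<longleftrightarrow> x = 0"
  using map_props(1) map_0 by blast

lemma inj_map: "inj_on \<phi> \<Lambda>"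
  using bij by (simp add: bij_betw_def)

lemma image_map: "\<phi> ` \<Lambda> = \<Lambda>'"
  using bij by (simp add: bij_betw_def)

lemma restrict_image:
  assumes "\<And>x. x \<in> \<Lambda> \<Longrightarrow> P (\<phi> x) \<longleftrightarrow> Q x"
  shows "{y \<in> \<Lambda>'. P y} = \<phi> ` {x \<in> \<Lambda>. Q x}"
  unfolding image_map[symmetric] using assms by blast

lemma deg_slice_image:
  "deg_slice \<Lambda>' (n + s) = \<phi> ` deg_slice \<Lambda> n"
  "n < s \<Longrightarrow> deg_slice \<Lambda>' n = {}"
proof -
  show "deg_slice \<Lambda>' (n + s) = \<phi> ` deg_slice \<Lambda> n"
    unfolding deg_slice_def
    by (rule restrict_image) (metis map_eq_0_iff map_props(2) of_nat_add add_right_cancel)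
  show "deg_slice \<Lambda>' n = {}" if "n < s"
  proof -
    have "deg_inf (\<phi> x) \<noteq> int n" if "x \<in> \<Lambda>" "\<phi> x \<noteq> 0" for x
      using that map_props(2)[of x] deg_nonneg[of x] \<open>n < s\<close> map_0 by (cases "x = 0") auto
    then show ?thesis
      unfolding deg_slice_def image_map[symmetric] by auto
  qed
qed

lemma inj_map_deg_slice: "inj_on \<phi> (deg_slice \<Lambda> n)"
  by (rule inj_on_subset[OF inj_map]) (auto simp: deg_slice_def)

text \<open>The products of signs agree after shifting the degree by \<open>s\<close>, and a shift
  of the index does not affect an eventual value.\<close>

lemma eta_image: "eta \<Lambda>' = eta \<Lambda>"
proof -
  have *: "(\<Prod>x\<in>deg_slice \<Lambda>' (M + s). sgn_inf x) = (\<Prod>x\<in>deg_slice \<Lambda> M. sgn_inf x)" for M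
    unfolding deg_slice_image(1) by (subst prod.reindex[OF inj_map_deg_slice])
      (auto intro!: prod.cong simp: deg_slice_def map_props)
  show ?thesis
    unfolding eta_def
    by (subst eventually_sequentially_seg[symmetric, of _ s]) (simp only: *)
qed

lemma t_exp_image: "t_exp \<Lambda>' = t_exp \<Lambda> - int s * (int CARD('a) - 1)"
  using deg_slice_image by (intro t_exp_shift) (auto simp: card_image inj_map_deg_slice)

text \<open>This is \<open>one_unit \<pi> g\<close>, since \<open>g\<close> has degree
  \<open>s\<close> and sign 1.\<close>

definition c :: "'a fls" where
  "c = g * \<pi> powi int s"

lemma c_near_1: "abs_inf (c - 1) < 1"
  unfolding abs_inf_near_1_iff using scale_nonzero uniformizer_nonzero
  by (simp add: c_def deg_inf_mult sgn_inf_mult deg_scale sgn_scale deg_inf_power sgn_inf_power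
      deg_uniformizer sgn_uniformizer)

text \<open>Every nonzero \<open>x\<close> in the ball contributes a factor
  \<open>c * \<rho> x\<close>. The additional \<open>c\<close> on the left raises the exponent of
  \<open>c\<close> by one, to the cardinality of the whole ball including 0, which is a power of
  q.\<close>

lemma u_partial_image:
  "u_partial \<pi> \<Lambda>' (M + s) * c =
    u_partial \<pi> \<Lambda> M * (c ^ card (ball_lt (Suc M)) * (\<Prod>x\<in>ball_lt (Suc M) - {0}. \<rho> x))"
proof -
  let ?B = "ball_lt (Suc M) - {0}"
  have B: "x \<in> ?B \<longleftrightarrow> x \<in> \<Lambda> \<and> x \<noteq> 0 \<and> deg_inf x \<le> int M" for x
    by (auto simp: mem_ball_lt_iff)
  have "{x \<in> \<Lambda>'. x \<noteq> 0 \<and> deg_inf x \<le> int (M + s)} = \<phi> ` ?B"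
  proof -
    have "?B = {x \<in> \<Lambda>. x \<noteq> 0 \<and> deg_inf x \<le> int M}"
      using B by blast
    moreover have "\<phi> x \<noteq> 0 \<and> deg_inf (\<phi> x) \<le> int (M + s) \<longleftrightarrow> x \<noteq> 0 \<and> deg_inf x \<le> int M"
      if "x \<in> \<Lambda>" for x
      using map_eq_0_iff[OF that] map_props(2)[OF that] by auto
    ultimately show ?thesis
      using restrict_image[of "\<lambda>y. y \<noteq> 0 \<and> deg_inf y \<le> int (M + s)"] by simp
  qed
  then have "u_partial \<pi> \<Lambda>' (M + s) = (\<Prod>x\<in>\<phi> ` ?B. one_unit \<pi> x)"
    by (simp add: u_partial_def)
  also have "\<dots> = (\<Prod>x\<in>?B. one_unit \<pi> (\<phi> x))"
    using inj_on_subset[OF inj_map, of ?B] B by (subst prod.reindex) auto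
  also have "\<dots> = (\<Prod>x\<in>?B. one_unit \<pi> x * (c * \<rho> x))"
  proof (rule prod.cong)
    fix x assume "x \<in> ?B"
    then have x: "x \<in> \<Lambda>" "x \<noteq> 0"
      unfolding B by auto
    have "one_unit \<pi> (\<phi> x) = \<phi> x * \<pi> powi (deg_inf x + int s) / fls_const (sgn_inf x)"
      by (simp only: one_unit_def map_props[OF x])
    also have "\<dots> = g * x * \<rho> x * (\<pi> powi deg_inf x * \<pi> powi int s) / fls_const (sgn_inf x)"
      using uniformizer_nonzero map_eq[of x] by (metis power_int_add)
    finally show "one_unit \<pi> (\<phi> x) = one_unit \<pi> x * (c * \<rho> x)"
      unfolding c_def one_unit_def[of \<pi> x] times_divide_eq_left by (simp only: mult_ac)
  qed simp
  also have "\<dots> = u_partial \<pi> \<Lambda> M * (c ^ card ?B * (\<Prod>x\<in>?B. \<rho> x))"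
    by (simp add: prod.distrib u_partial_conv_ball_lt)
  finally have "u_partial \<pi> \<Lambda>' (M + s) * c =
      u_partial \<pi> \<Lambda> M * (c ^ Suc (card ?B) * (\<Prod>x\<in>?B. \<rho> x))"
    by (simp add: mult_ac)
  moreover have "Suc (card ?B) = card (ball_lt (Suc M))"
    using finite_ball_lt zero_mem by (intro card.remove[symmetric]) (auto simp: mem_ball_lt_iff)
  ultimately show ?thesis
    by simp
qed

text \<open>In \<open>u_partial_image\<close> the power of the one-unit \<open>c\<close> has
  exponent \<open>q^k\<close> with \<open>k\<close> unbounded and so tends to 1, while the product
  of the \<open>\<rho> x\<close> stays within \<epsilon> of 1.\<close>

lemma u_lim_image_near: "abs_inf (u_lim \<pi> \<Lambda>' * c / u_lim \<pi> \<Lambda> - 1) \<le> \<epsilon>"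
proof -
  let ?U = "u_partial \<pi> \<Lambda>" and ?U' = "u_partial \<pi> \<Lambda>'"
  define \<delta> where "\<delta> = abs_inf (c - 1)"
  have \<delta>: "0 \<le> \<delta>" "\<delta> < 1"
    using c_near_1 by (auto simp: \<delta>_def inf.nrm_nonneg)
  then have "(\<lambda>n. \<delta> ^ n) \<longlonglongrightarrow> 0"
    by (intro LIMSEQ_realpow_zero)
  then obtain n where n: "\<delta> ^ n < \<epsilon>"
    using order_tendstoD(2)[of "\<lambda>n. \<delta> ^ n" 0 sequentially \<epsilon>] eps
    by (auto simp: eventually_sequentially)
  have abs_c: "abs_inf c = 1"
    using c_near_1 by (rule inf.nrm_eq_1_of_near_1)
  have ev1: "\<forall>\<^sub>F M in sequentially. \<exists>k\<ge>n. card (ball_lt (Suc M)) = CARD('a) ^ k"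
    using eventually_card_ball_lt_ge[of n] by (subst eventually_sequentially_Suc)
  have ev2: "\<forall>\<^sub>F M in sequentially. abs_inf (?U' (M + s) - u_lim \<pi> \<Lambda>') \<le> \<epsilon>"
    using image.u_partial_converges[OF eps(1)] by (subst eventually_sequentially_seg)
  \<comment> \<open>The claim does not depend on \<open>M\<close>; the quantifier supplies one
    \<open>M\<close> that is large enough for all three estimates.\<close>
  have "\<forall>\<^sub>F M in sequentially. abs_inf (u_lim \<pi> \<Lambda>' * c - u_lim \<pi> \<Lambda>) \<le> \<epsilon>"
    using ev1 ev2 u_partial_converges[OF eps(1)]
  proof eventually_elim
    case (elim M)
    then obtain k where k: "k \<ge> n" "card (ball_lt (Suc M)) = CARD('a) ^ k"
      by blast
    have "abs_inf (c ^ (CARD('a) ^ k) - 1) \<le> \<delta> ^ Suc k"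
      using \<delta> of_nat_CARD_fls_eq_0 by (intro inf.nrm_power_char_near_1) (auto simp: \<delta>_def)
    also have "\<dots> \<le> \<delta> ^ n"
      using \<delta> k(1) by (intro power_decreasing) auto
    finally have "abs_inf (c ^ card (ball_lt (Suc M)) - 1) \<le> \<epsilon>"
      using n k(2) by simp
    moreover have "abs_inf ((\<Prod>x\<in>ball_lt (Suc M) - {0}. \<rho> x) - 1) \<le> \<epsilon>"
      using \<rho>_near_1 eps by (intro inf.nrm_prod_near_1) (auto simp: mem_ball_lt_iff)
    ultimately have "abs_inf (c ^ card (ball_lt (Suc M)) * (\<Prod>x\<in>ball_lt (Suc M) - {0}. \<rho> x) - 1) \<le> \<epsilon>"
      using eps by (intro inf.nrm_mult_near_1) auto
    then have "abs_inf (?U M * (c ^ card (ball_lt (Suc M)) * (\<Prod>x\<in>ball_lt (Suc M) - {0}. \<rho> x) - 1)) \<le> \<epsilon>"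
      by (simp add: inf.nrm_mult abs_inf_u_partial)
    then have 1: "abs_inf (?U' (M + s) * c - ?U M) \<le> \<epsilon>"
      unfolding u_partial_image by (simp add: algebra_simps)
    have 2: "abs_inf ((?U' (M + s) - u_lim \<pi> \<Lambda>') * c) \<le> \<epsilon>"
      using elim(2) by (simp add: inf.nrm_mult abs_c)
    have "u_lim \<pi> \<Lambda>' * c - u_lim \<pi> \<Lambda> =
        (?U' (M + s) * c - ?U M) - (?U' (M + s) - u_lim \<pi> \<Lambda>') * c + (?U M - u_lim \<pi> \<Lambda>)"
      by (simp add: algebra_simps)
    then show ?case
      using 1 2 elim(3) by (simp only: inf.nrm_add_bound inf.nrm_diff_bound)
  qed
  then have *: "abs_inf (u_lim \<pi> \<Lambda>' * c - u_lim \<pi> \<Lambda>) \<le> \<epsilon>"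
    by simp
  have "u_lim \<pi> \<Lambda> \<noteq> 0"
    using abs_inf_u_lim by auto
  then have "u_lim \<pi> \<Lambda>' * c / u_lim \<pi> \<Lambda> - 1 = (u_lim \<pi> \<Lambda>' * c - u_lim \<pi> \<Lambda>) / u_lim \<pi> \<Lambda>"
    by (simp add: field_simps)
  then show ?thesis
    using * by (simp add: inf.nrm_divide abs_inf_u_lim)
qed

end

section \<open>Exponential functions of perturbed lattices\<close>

definition emb_k ::
  "('a::finite_field fls alg_closure \<Rightarrow> 'c::field) \<Rightarrow> 'a fls \<Rightarrow> 'c" where
  "emb_k emb x = emb (to_ac x)"

sublocale C_infinity \<subseteq> C: ultrametric_norm "\<lambda>z :: 'c. dist z 0"
  by standard (use abs_mult abs_ultrametric in auto)

context C_infinity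
begin

lemma emb_k_1 [simp]: "emb_k emb 1 = 1"
  by (simp add: emb_k_def emb_1)

lemma emb_k_mult: "emb_k emb (x * y) = emb_k emb x * emb_k emb y"
  by (simp add: emb_k_def emb_mult)

lemma emb_k_add: "emb_k emb (x + y) = emb_k emb x + emb_k emb y"
  by (simp add: emb_k_def emb_add)

lemma emb_k_0 [simp]: "emb_k emb 0 = 0"
  using emb_k_add[of 0 0] by (metis add.right_neutral add_left_cancel)

lemma emb_k_diff: "emb_k emb (x - y) = emb_k emb x - emb_k emb y"
  using emb_k_add[of "x - y" y] by (simp add: eq_diff_eq)

lemma emb_k_power: "emb_k emb (x ^ n) = emb_k emb x ^ n"
  by (induction n) (simp_all add: emb_k_mult)

lemma norm_emb_k: "dist (emb_k emb x) 0 = abs_inf x"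
  by (simp add: emb_k_def abs_extends)

lemma emb_k_eq_0_iff [simp]: "emb_k emb x = 0 \<longleftrightarrow> x = 0"
  using norm_emb_k[of x] by (metis C.nrm_eq_0_iff inf.nrm_eq_0_iff)

lemma emb_k_eq_iff [simp]: "emb_k emb x = emb_k emb y \<longleftrightarrow> x = y"
  using emb_k_eq_0_iff[of "x - y"] by (simp add: emb_k_diff del: emb_k_eq_0_iff)

lemma emb_k_divide: "emb_k emb (x / y) = emb_k emb x / emb_k emb y"
proof (cases "y = 0")
  case False
  then show ?thesis
    using emb_k_mult[of "x / y" y] by (simp add: field_simps)
qed simp

text \<open>The polynomial \<open>X^(q-1) - 1\<close> has at most \<open>q - 1\<close> roots, and
  the nonzero constants already account for that many. Hence the choice of a root \<xi> only matters
  up to a constant, under which the lattices are stable.\<close>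

lemma root_of_unity_const:
  assumes "w ^ (CARD('a) - 1) = (1 :: 'c)"
  obtains c :: 'a where "c \<noteq> 0" "w = emb_k emb (fls_const c)"
proof -
  let ?n = "CARD('a) - 1"
  define p :: "'c poly" where "p = Polynomial.monom 1 ?n - 1"
  have n: "?n > 0"
    using CARD_ge_2[where 'a = 'a] by simp
  have "Polynomial.coeff p ?n = 1"
    using n by (simp add: p_def)
  then have "p \<noteq> 0"
    by auto
  then have "finite {x. poly p x = 0}" "card {x. poly p x = 0} \<le> Polynomial.degree p"
    by (auto intro: poly_roots_finite card_poly_roots_bound)
  moreover have "Polynomial.degree p \<le> ?n"
    unfolding p_def by (intro degree_diff_le) (auto simp: degree_monom_le)
  moreover have "{x. poly p x = 0} = {x. x ^ ?n = 1}"
    by (simp add: p_def poly_monom)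
  ultimately have fin: "finite {x :: 'c. x ^ ?n = 1}" and card: "card {x :: 'c. x ^ ?n = 1} \<le> ?n"
    by simp_all
  let ?I = "(\<lambda>c. emb_k emb (fls_const c)) ` (UNIV - {0})"
  have "c ^ ?n = 1" if "c \<noteq> 0" for c :: 'a
  proof -
    have "Suc ?n = CARD('a)"
      using n by simp
    then have "c * c ^ ?n = c"
      using finite_field_power_card_eq_same[of c] by (metis power_Suc)
    with that show ?thesis by simp
  qed
  then have "?I \<subseteq> {x. x ^ ?n = 1}"
    by (auto simp flip: emb_k_power fls_const_power)
  moreover have "card ?I = ?n"
    by (subst card_image) (auto simp: inj_on_def card_Diff_singleton dest: arg_cong[of _ _ sgn_inf])
  ultimately have "?I = {x. x ^ ?n = 1}"
    using fin card by (intro card_seteq) auto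
  with assms show ?thesis
    using that by blast
qed

section \<open>Infinite products over discrete sets\<close>

text \<open>Bounds all finite products of \<open>max 1 (dist (x i) 0)\<close>, provided only
  finitely many \<open>x i\<close> have absolute value at least 1.\<close>

definition prod_bound :: "'i set \<Rightarrow> ('i \<Rightarrow> 'c) \<Rightarrow> real" where
  "prod_bound I x = (\<Prod>i | i \<in> I \<and> 1 \<le> dist (x i) 0. dist (x i) 0)"

lemma prod_max_le_prod_bound:
  assumes "finite {i \<in> I. 1 \<le> dist (x i) 0}" "finite F" "F \<subseteq> I"
  shows "(\<Prod>i\<in>F. max 1 (dist (x i) 0)) \<le> prod_bound I x"
proof -
  have "(\<Prod>i\<in>F. max 1 (dist (x i) 0)) = (\<Prod>i\<in>{i \<in> F. 1 \<le> dist (x i) 0}. dist (x i) 0)"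
    using assms(2) by (intro prod.mono_neutral_cong_right) auto
  also have "\<dots> \<le> prod_bound I x"
    unfolding prod_bound_def using assms by (intro prod_mono2) auto
  finally show ?thesis .
qed

lemma prod_bound_nonneg: "0 \<le> prod_bound I x"
  unfolding prod_bound_def by (intro prod_nonneg) auto

lemma prod_diff_le_prod_bound:
  fixes a b :: "'i \<Rightarrow> 'c"
  assumes "finite {i \<in> I. 1 \<le> dist (x i) 0}" "finite F" "F \<subseteq> I" "0 \<le> r"
    and "\<And>i. i \<in> F \<Longrightarrow> dist (a i) 0 \<le> max 1 (dist (x i) 0)"
    and "\<And>i. i \<in> F \<Longrightarrow> dist (b i) 0 \<le> max 1 (dist (x i) 0)"
    and "\<And>i. i \<in> F \<Longrightarrow> dist (a i - b i) 0 \<le> r * max 1 (dist (x i) 0)"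
  shows "dist (\<Prod>i\<in>F. a i) (\<Prod>i\<in>F. b i) \<le> r * prod_bound I x"
proof -
  have "dist (\<Prod>i\<in>F. a i) (\<Prod>i\<in>F. b i) \<le> r * (\<Prod>i\<in>F. max 1 (dist (x i) 0))"
    unfolding dist_diff[of "\<Prod>i\<in>F. a i"] using assms by (intro C.nrm_prod_diff_le)
  also have "\<dots> \<le> r * prod_bound I x"
    using assms by (intro mult_left_mono prod_max_le_prod_bound)
  finally show ?thesis .
qed

lemma norm_one_minus_le: "dist (1 - x :: 'c) 0 \<le> max 1 (dist x 0)"
  using C.nrm_diff_le[of 1 x] by simp

text \<open>Factors outside \<open>big n\<close> are within \<open>1/(n+1)\<close> of 1, so any
  finite product over a set containing \<open>big n\<close> differs from the one over
  \<open>big n\<close> by at most \<open>C/(n+1)\<close>. The products over \<open>big n\<close>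
  thus form a Cauchy sequence whose limit is also the unordered one.\<close>

lemma infinite_product_converges:
  fixes x :: "'i \<Rightarrow> 'c"
  assumes fin: "\<And>r. r > 0 \<Longrightarrow> finite {i \<in> I. r \<le> dist (x i) 0}"
  obtains l where "((\<lambda>F. \<Prod>i\<in>F. 1 - x i) \<longlongrightarrow> l) (finite_subsets_at_top I)"
proof -
  define C where "C = prod_bound I x"
  define P where "P F = (\<Prod>i\<in>F. 1 - x i)" for F
  define big where "big n = {i \<in> I. inverse (real (Suc n)) \<le> dist (x i) 0}" for n
  have big: "finite (big n)" "big n \<subseteq> I" for n
    using fin[of "inverse (real (Suc n))"] by (auto simp: big_def)
  have near: "dist (P F) (P (big n)) \<le> inverse (real (Suc n)) * C"
    if "finite F" "big n \<subseteq> F" "F \<subseteq> I" for F n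
  proof -
    \<comment> \<open>Missing factors are replaced by 1, so that both products run over
      \<open>F\<close>.\<close>
    have "P (big n) = (\<Prod>i\<in>F. if i \<in> big n then 1 - x i else 1)"
      unfolding P_def using that by (intro prod.mono_neutral_cong_left) auto
    moreover have "dist (\<Prod>i\<in>F. 1 - x i) (\<Prod>i\<in>F. if i \<in> big n then 1 - x i else 1) \<le>
        inverse (real (Suc n)) * C"
      unfolding C_def
    proof (intro prod_diff_le_prod_bound)
      fix i assume i: "i \<in> F"
      have "dist (x i) 0 \<le> inverse (real (Suc n)) * max 1 (dist (x i) 0)" if "i \<notin> big n"
      proof -
        have "dist (x i) 0 \<le> inverse (real (Suc n)) * 1"
          using that i \<open>F \<subseteq> I\<close> by (auto simp: big_def)
        also have "\<dots> \<le> inverse (real (Suc n)) * max 1 (dist (x i) 0)"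
          by (intro mult_left_mono) auto
        finally show ?thesis .
      qed
      then show "dist (1 - x i - (if i \<in> big n then 1 - x i else 1)) 0 \<le>
          inverse (real (Suc n)) * max 1 (dist (x i) 0)"
        by (auto simp: le_max_iff_disj)
    qed (use fin[of 1] that norm_one_minus_le in auto)
    ultimately show ?thesis
      by (simp add: P_def)
  qed
  have C: "C \<ge> 0"
    by (simp add: C_def prod_bound_nonneg)
  have small: "\<exists>n. inverse (real (Suc n)) * C < e" if "e > 0" for e
  proof -
    obtain n where "C / e < real n"
      using reals_Archimedean2 by blast
    then have "C < e * real (Suc n)"
      using that by (simp add: pos_divide_less_eq mult.commute distrib_left)
    then show ?thesis
      by (intro exI[of _ n]) (simp add: field_simps)
  qed
  have mono: "big n \<subseteq> big m" if "n \<le> m" for n m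
  proof -
    have "inverse (real (Suc m)) \<le> inverse (real (Suc n))"
      using that by (intro le_imp_inverse_le) auto
    then show ?thesis
      unfolding big_def by (blast intro: order_trans)
  qed
  have "Cauchy (\<lambda>n. P (big n))"
  proof (rule metric_CauchyI)
    fix e :: real assume "e > 0"
    then obtain n where n: "inverse (real (Suc n)) * C < e / 2"
      using small[of "e / 2"] by auto
    have "dist (P (big m)) (P (big k)) < e" if "m \<ge> n" "k \<ge> n" for m k
      using near[of "big m" n] near[of "big k" n] that mono big n
        dist_triangle2[of "P (big m)" "P (big k)" "P (big n)"]
      by fastforce
    then show "\<exists>n. \<forall>m\<ge>n. \<forall>k\<ge>n. dist (P (big m)) (P (big k)) < e"
      by blast
  qed
  then obtain l where l: "(\<lambda>n. P (big n)) \<longlonglongrightarrow> l"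
    using Cauchy_convergent convergent_def by blast
  have "(P \<longlongrightarrow> l) (finite_subsets_at_top I)"
  proof (rule tendstoI)
    fix e :: real assume "e > 0"
    then obtain n where n: "inverse (real (Suc n)) * C < e / 2"
      using small[of "e / 2"] by auto
    have "\<forall>\<^sub>F m in sequentially. dist (P (big m)) l < e / 2"
      using l \<open>e > 0\<close> by (intro tendstoD) auto
    then obtain m where m: "m \<ge> n" "dist (P (big m)) l < e / 2"
      unfolding eventually_sequentially by (metis le_cases)
    have "dist (P F) l < e" if F: "finite F" "big m \<subseteq> F" "F \<subseteq> I" for F
    proof -
      have "inverse (real (Suc m)) * C \<le> inverse (real (Suc n)) * C"
        using m(1) C by (intro mult_right_mono le_imp_inverse_le) auto
      with near[OF F] n m(2) show ?thesis
        using dist_triangle[of "P F" l "P (big m)"] by linarith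
    qed
    then show "\<forall>\<^sub>F F in finite_subsets_at_top I. dist (P F) l < e"
      unfolding eventually_finite_subsets_at_top using big[of m] by blast
  qed
  then show ?thesis
    using that by (simp add: P_def[abs_def])
qed

text \<open>Reindexes the unordered product, so that the exponentials of two lattices can be
  compared over one index set.\<close>

lemma exp_lattice_eqI:
  assumes inj: "inj_on h I" and L: "L - {0} = h ` I"
    and lim: "((\<lambda>F. \<Prod>i\<in>F. 1 - z / h i) \<longlongrightarrow> l) (finite_subsets_at_top I)"
  shows "exp_lattice L z = z * l"
proof -
  have "((\<lambda>F. \<Prod>x\<in>h ` F. 1 - z / x) \<longlongrightarrow> l) (finite_subsets_at_top I)"
  proof (rule Lim_transform_eventually[OF lim])
    show "\<forall>\<^sub>F F in finite_subsets_at_top I. (\<Prod>i\<in>F. 1 - z / h i) = (\<Prod>x\<in>h ` F. 1 - z / x)"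
      using inj_on_subset[OF inj]
      by (intro eventually_finite_subsets_at_top_weakI) (simp add: prod.reindex)
  qed
  then have "((\<lambda>F. \<Prod>x\<in>F. 1 - z / x) \<longlongrightarrow> l) (finite_subsets_at_top (L - {0}))"
    unfolding L filtermap_image_finite_subsets_at_top[OF inj, symmetric] filterlim_filtermap .
  then have "Lim (finite_subsets_at_top (L - {0})) (\<lambda>F. \<Prod>x\<in>F. 1 - z / x) = l"
    by (intro tendsto_Lim) (simp_all add: finite_subsets_at_top_neq_bot)
  then show ?thesis
    by (simp add: exp_lattice_def)
qed

section \<open>Comparison of the exponential functions of two lattices\<close>

definition is_scale :: "'a fls \<Rightarrow> 'a fls set \<Rightarrow> 'c \<Rightarrow> bool" where
  "is_scale \<pi> \<Lambda> \<xi> \<longleftrightarrow> \<xi> ^ (CARD('a) - 1) =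
    emb (to_ac (inverse (fls_const (eta \<Lambda>)) * \<pi> powi (- t_exp \<Lambda>) *
      u_lim \<pi> \<Lambda> ^ (CARD('a) - 1)))"

lemma is_scale_iff:
  "is_scale \<pi> \<Lambda> \<xi> \<longleftrightarrow> \<xi> ^ (CARD('a) - 1) =
    emb_k emb (inverse (fls_const (eta \<Lambda>)) * \<pi> powi (- t_exp \<Lambda>) *
      u_lim \<pi> \<Lambda> ^ (CARD('a) - 1))"
  by (simp only: is_scale_def emb_k_def)

text \<open>The behaviour of \<eta>, \<open>t\<close> and \<open>u\<close> gives
  \<open>\<xi>' = \<xi> * (v / g) * a\<close> with \<open>v\<close> close to 1 and \<open>a\<close>
  a constant, so corresponding points of the scaled lattices have ratios close to 1. What matters is
  that \<open>K\<close> depends on \<Lambda>, \<xi> and \<open>z\<close> only, not on the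
  perturbation.\<close>

lemma exp_scaled_perturbation:
  assumes "fq_lattice_uniformizer \<Lambda> \<pi>" and \<xi>: "is_scale \<pi> \<Lambda> \<xi>"
  obtains K where "\<And>\<Lambda>' \<phi> g s \<epsilon> \<xi>'. perturbation \<Lambda> \<Lambda>' \<pi> \<phi> g s \<epsilon> \<Longrightarrow> is_scale \<pi> \<Lambda>' \<xi>' \<Longrightarrow>
    dist (exp_scaled emb \<xi>' \<Lambda>' z) (exp_scaled emb \<xi> \<Lambda> z) \<le> \<epsilon> * K"
proof (cases "\<xi> = 0")
  \<comment> \<open>If \<xi> is 0, then so are \<open>eta \<Lambda>\<close> and, by
    \<open>eta_image\<close>, \<open>\<xi>'\<close>; both scaled lattices reduce to 0 and both
    exponentials are the identity.\<close>
  case True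
  have n: "CARD('a) - 1 > 0"
    using CARD_ge_2[where 'a = 'a] by simp
  have exp_0: "exp_scaled emb 0 \<Lambda>' z = z" for \<Lambda>'
  proof -
    have "(\<lambda>x. 0 * emb (to_ac x)) ` \<Lambda>' - {0} = {}"
      by auto
    then show ?thesis
      unfolding exp_scaled_def by (subst exp_lattice_eqI[of "\<lambda>_. 0" "{}" _ z 1])
        (auto intro: tendsto_eventually always_eventually)
  qed
  interpret fq_lattice_uniformizer \<Lambda> \<pi> by fact
  have eta: "eta \<Lambda> = 0"
  proof -
    have "emb_k emb (inverse (fls_const (eta \<Lambda>)) * \<pi> powi (- t_exp \<Lambda>) *
        u_lim \<pi> \<Lambda> ^ (CARD('a) - 1)) = 0"
      using \<xi> n unfolding is_scale_iff True by (metis zero_power)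
    moreover have "u_lim \<pi> \<Lambda> \<noteq> 0"
      using abs_inf_u_lim by auto
    ultimately show ?thesis
      using uniformizer_nonzero by simp
  qed
  show ?thesis
  proof (rule that[of 0])
    fix \<Lambda>' \<phi> g s \<epsilon> \<xi>'
    assume "perturbation \<Lambda> \<Lambda>' \<pi> \<phi> g s \<epsilon>" and \<xi>': "is_scale \<pi> \<Lambda>' \<xi>'"
    then have "eta \<Lambda>' = 0"
      using eta perturbation.eta_image by metis
    then have "\<xi>' ^ (CARD('a) - 1) = 0"
      using \<xi>' by (simp add: is_scale_iff)
    then have "\<xi>' = 0"
      by simp
    then show "dist (exp_scaled emb \<xi>' \<Lambda>' z) (exp_scaled emb \<xi> \<Lambda> z) \<le> \<epsilon> * 0"
      using True by (simp add: exp_0)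
  qed
next
  case \<xi>0: False
  interpret fq_lattice_uniformizer \<Lambda> \<pi> by fact
  define h where "h x = \<xi> * emb_k emb x" for x
  define I where "I = \<Lambda> - {0}"
  have h0: "h x \<noteq> 0" if "x \<in> I" for x
    using that \<xi>0 by (simp add: h_def I_def)
  have fin: "finite {x \<in> I. r \<le> dist (z / h x) 0}" if "r > 0" for r
  proof -
    \<comment> \<open>From \<open>r \<le> |z / (\<xi> x)|\<close> follows
      \<open>|x| \<le> |z| / (r |\<xi>|)\<close>, which leaves finitely many \<open>x\<close>. The
      summand 1 in the denominator covers \<open>z = 0\<close>.\<close>
    have "r * dist \<xi> 0 / (dist z 0 + 1) > 0"
      using that \<xi>0 by (intro divide_pos_pos mult_pos_pos) (auto intro: add_nonneg_pos)
    then obtain n :: nat where n: "real CARD('a) powi (- int n) < r * dist \<xi> 0 / (dist z 0 + 1)"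
      by (rule CARD_powi_less_ex)
    have "x \<in> ball_lt (Suc n)" if x: "x \<in> I" "r \<le> dist (z / h x) 0" for x
    proof -
      have pos: "abs_inf x > 0" "dist \<xi> 0 > 0"
        using x(1) \<xi>0 inf.nrm_nonneg[of x] by (auto simp: I_def less_le inf.nrm_eq_0_iff)
      have "r * (dist \<xi> 0 * abs_inf x) \<le> dist z 0"
        using x(2) pos by (simp add: h_def C.nrm_divide C.nrm_mult norm_emb_k field_simps)
      moreover have "1 + dist z 0 > 0"
        by (intro add_pos_nonneg) auto
      ultimately have "r * dist \<xi> 0 / (dist z 0 + 1) * abs_inf x < 1"
        by (simp add: field_simps)
      moreover have "real CARD('a) powi (- int n) * abs_inf x < r * dist \<xi> 0 / (dist z 0 + 1) * abs_inf x"
        using n pos by (intro mult_strict_right_mono)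
      ultimately have "real CARD('a) powi (- int n) * abs_inf x < 1"
        by linarith
      then have "abs_inf x < real CARD('a) powi int n"
        using CARD_ge_2[where 'a = 'a] by (simp add: power_int_minus field_simps)
      also have "\<dots> \<le> real CARD('a) powi int (Suc n)"
        unfolding CARD_powi_le_iff by simp
      finally show ?thesis
        using x(1) by (simp add: ball_lt_def I_def del: power_int_of_nat)
    qed
    then show ?thesis
      by (intro finite_subset[OF _ finite_ball_lt]) blast
  qed
  define P where "P = prod_bound I (\<lambda>x. z / h x)"
  obtain l where l: "((\<lambda>F. \<Prod>x\<in>F. 1 - z / h x) \<longlongrightarrow> l) (finite_subsets_at_top I)"
    using infinite_product_converges[OF fin] by blast
  have exp_l: "exp_scaled emb \<xi> \<Lambda> z = z * l"
    unfolding exp_scaled_def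
  proof (rule exp_lattice_eqI[OF _ _ l])
    show "inj_on h I"
      using \<xi>0 by (auto simp: inj_on_def h_def)
    show "(\<lambda>x. \<xi> * emb (to_ac x)) ` \<Lambda> - {0} = h ` I"
      using \<xi>0 by (auto simp: h_def I_def simp flip: emb_k_def)
  qed
  show ?thesis
  proof (rule that[of "dist z 0 * P"])
    fix \<Lambda>' \<phi> g s \<epsilon> \<xi>'
    assume "perturbation \<Lambda> \<Lambda>' \<pi> \<phi> g s \<epsilon>" and \<xi>': "is_scale \<pi> \<Lambda>' \<xi>'"
    then interpret perturbation \<Lambda> \<Lambda>' \<pi> \<phi> g s \<epsilon> by blast
    define v where "v = u_lim \<pi> \<Lambda>' * c / u_lim \<pi> \<Lambda>"
    let ?n = "CARD('a) - 1"
    have u0: "u_lim \<pi> \<Lambda> \<noteq> 0" "u_lim \<pi> \<Lambda>' \<noteq> 0"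
      using abs_inf_u_lim image.abs_inf_u_lim by auto
    have v: "abs_inf (v - 1) \<le> \<epsilon>"
      unfolding v_def by (rule u_lim_image_near)
    have v0: "v \<noteq> 0"
      using v eps by auto
    have c0: "c \<noteq> 0"
      using scale_nonzero uniformizer_nonzero by (simp add: c_def)
    \<comment> \<open>The change of \<open>t\<close> by \<open>- s (q - 1)\<close> becomes a perfect
      power with exponent \<open>q - 1\<close>, which can be combined with the power of
      \<open>u\<close>.\<close>
    have t': "\<pi> powi (- t_exp \<Lambda>') = \<pi> powi (- t_exp \<Lambda>) * (\<pi> powi int s) ^ ?n"
    proof -
      have "int CARD('a) - 1 = int ?n"
        using CARD_ge_2[where 'a = 'a] by simp
      then have e: "- t_exp \<Lambda>' = - t_exp \<Lambda> + int s * int ?n"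
        by (simp add: t_exp_image)
      have "(\<pi> powi int s) ^ ?n = \<pi> powi (int s * int ?n)"
        by (simp only: power_int_mult power_int_of_nat)
      then show ?thesis
        unfolding e by (simp only: power_int_add[OF disjI1[OF uniformizer_nonzero]])
    qed
    have u': "u_lim \<pi> \<Lambda>' = u_lim \<pi> \<Lambda> * (v / c)"
      using u0 c0 by (simp add: v_def)
    have vg: "\<pi> powi int s * (v / c) = v / g"
      using scale_nonzero uniformizer_nonzero by (simp add: c_def)
    have "\<pi> powi (- t_exp \<Lambda>') * u_lim \<pi> \<Lambda>' ^ ?n =
        \<pi> powi (- t_exp \<Lambda>) * u_lim \<pi> \<Lambda> ^ ?n * (v / g) ^ ?n"
      unfolding t' u' vg[symmetric] power_mult_distrib by (simp only: mult_ac)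
    then have "\<xi>' ^ ?n = \<xi> ^ ?n * emb_k emb (v / g) ^ ?n"
      using \<xi> \<xi>' unfolding is_scale_iff eta_image
      by (simp add: mult.assoc flip: emb_k_power emb_k_mult)
    \<comment> \<open>Both sides are known only through their powers with exponent
      \<open>q - 1\<close>, so the ratio is a root of unity, that is, a constant.\<close>
    then have "(\<xi>' / (\<xi> * emb_k emb (v / g))) ^ ?n = 1"
      using \<xi>0 v0 scale_nonzero by (simp add: power_divide power_mult_distrib)
    then obtain a where a: "a \<noteq> 0" "\<xi>' / (\<xi> * emb_k emb (v / g)) = emb_k emb (fls_const a)"
      by (rule root_of_unity_const)
    then have \<xi>'_eq: "\<xi>' = \<xi> * emb_k emb (v / g * fls_const a)"
      using \<xi>0 v0 scale_nonzero by (simp only: emb_k_mult) (simp add: field_simps)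
    \<comment> \<open>The constant \<open>a\<close> is omitted because multiplication by it permutes
      \<Lambda>'; so \<open>h'\<close> parametrises the same scaled lattice by the index set
      \<open>I\<close> of \<open>h\<close>.\<close>
    define h' where "h' x = \<xi> * emb_k emb (v / g * \<phi> x)" for x
    have inj: "inj_on h' I"
      using inj_map \<xi>0 v0 scale_nonzero by (auto simp: inj_on_def h'_def I_def)
    have const_image: "(\<lambda>y. fls_const a * y) ` \<Lambda>' = \<Lambda>'"
    proof (intro equalityI subsetI)
      fix y assume "y \<in> \<Lambda>'"
      then have "fls_const (inverse a) * y \<in> \<Lambda>'"
        by (rule image.const_mult_mem)
      moreover have "y = fls_const a * (fls_const (inverse a) * y)"
        using a(1) by (simp add: mult.assoc[symmetric])
      ultimately show "y \<in> (\<lambda>y. fls_const a * y) ` \<Lambda>'"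
        by blast
    qed (auto intro: image.const_mult_mem)
    have "(\<lambda>x. \<xi>' * emb_k emb x) ` \<Lambda>' = (\<lambda>x. \<xi> * emb_k emb (v / g * x)) ` ((\<lambda>y. fls_const a * y) ` \<Lambda>')"
      unfolding image_image \<xi>'_eq by (simp only: emb_k_mult mult.assoc)
    also have "\<dots> = h' ` \<Lambda>"
      unfolding const_image unfolding image_map[symmetric] by (simp add: image_image h'_def)
    finally have "(\<lambda>x. \<xi>' * emb_k emb x) ` \<Lambda>' = h' ` \<Lambda>" .
    then have L': "(\<lambda>x. \<xi>' * emb (to_ac x)) ` \<Lambda>' - {0} = h' ` I"
      using \<xi>0 v0 scale_nonzero map_eq_0_iff by (auto simp: h'_def I_def simp flip: emb_k_def)
    have h'_eq: "z / h' x = z / h x * emb_k emb (inverse (v * \<rho> x))" if "x \<in> I" for x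
      using scale_nonzero that
      by (simp add: h'_def h_def map_eq emb_k_mult emb_k_divide inverse_eq_divide)
    have y: "dist (emb_k emb (inverse (v * \<rho> x)) - 1) 0 \<le> \<epsilon>" if "x \<in> I" for x
    proof -
      have "abs_inf (inverse (v * \<rho> x) - 1) \<le> \<epsilon>"
        using v \<rho>_near_1[of x] that eps
        by (intro inf.nrm_inverse_near_1 inf.nrm_mult_near_1) (auto simp: I_def)
      then show ?thesis
        using emb_k_diff[of _ 1] norm_emb_k by (metis emb_k_1)
    qed
    have y1: "dist (emb_k emb (inverse (v * \<rho> x))) 0 = 1" if "x \<in> I" for x
      using y[OF that] eps by (intro C.nrm_eq_1_of_near_1) auto
    have norm_h': "dist (z / h' x) 0 = dist (z / h x) 0" if "x \<in> I" for x
      using y1[OF that] unfolding h'_eq[OF that] C.nrm_mult by simp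
    have "finite {x \<in> I. r \<le> dist (z / h' x) 0}" if "r > 0" for r
      using fin[OF that] norm_h' by (metis (mono_tags, lifting) Collect_cong)
    then obtain l' where l': "((\<lambda>F. \<Prod>x\<in>F. 1 - z / h' x) \<longlongrightarrow> l') (finite_subsets_at_top I)"
      using infinite_product_converges[of I "\<lambda>x. z / h' x"] by blast
    have exp_l': "exp_scaled emb \<xi>' \<Lambda>' z = z * l'"
      unfolding exp_scaled_def by (rule exp_lattice_eqI[OF inj L' l'])
    have "dist (\<Prod>x\<in>F. 1 - z / h' x) (\<Prod>x\<in>F. 1 - z / h x) \<le> \<epsilon> * P" if F: "finite F" "F \<subseteq> I" for F
      unfolding P_def
    proof (rule prod_diff_le_prod_bound)
      fix x assume "x \<in> F"
      then have x: "x \<in> I"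
        using F by blast
      show "dist (1 - z / h' x) 0 \<le> max 1 (dist (z / h x) 0)"
        using norm_one_minus_le[of "z / h' x"] norm_h'[OF x] by simp
      have "1 - z / h' x - (1 - z / h x) = - (z / h x * (emb_k emb (inverse (v * \<rho> x)) - 1))"
        unfolding h'_eq[OF x] by (simp add: algebra_simps)
      also have "dist \<dots> 0 = dist (z / h x) 0 * dist (emb_k emb (inverse (v * \<rho> x)) - 1) 0"
        unfolding C.nrm_minus C.nrm_mult ..
      also have "\<dots> \<le> max 1 (dist (z / h x) 0) * \<epsilon>"
        using y[OF x] by (intro mult_mono) auto
      finally show "dist (1 - z / h' x - (1 - z / h x)) 0 \<le> \<epsilon> * max 1 (dist (z / h x) 0)"
        by (simp add: mult.commute)
    qed (use F fin[of 1] eps norm_one_minus_le in auto)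
    \<comment> \<open>The bound is independent of \<open>F\<close> and therefore passes to the limit
      along finite subsets.\<close>
    then have "dist l' l \<le> \<epsilon> * P"
      by (intro tendsto_upperbound[OF tendsto_dist[OF l' l]] eventually_finite_subsets_at_top_weakI)
        (simp_all add: finite_subsets_at_top_neq_bot)
    then have "dist (z * (l' - l)) 0 \<le> dist z 0 * (\<epsilon> * P)"
      unfolding C.nrm_mult by (intro mult_left_mono) (simp_all add: dist_diff[of l' l])
    then show "dist (exp_scaled emb \<xi>' \<Lambda>' z) (exp_scaled emb \<xi> \<Lambda> z) \<le> \<epsilon> * (dist z 0 * P)"
      unfolding exp_l exp_l' dist_diff[of "z * l'"] by (simp add: algebra_simps)
  qed
qed

end

section \<open>The ideals in terms of conjugates\<close>

lemma abs_inf_const_le: "abs_inf (fls_const c) \<le> 1"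
  by (simp add: abs_inf_def)

lemma add_smaller:
  fixes x y :: "'a::finite_field fls"
  assumes "x \<noteq> 0" "abs_inf y < abs_inf x"
  shows "x + y \<noteq> 0" "deg_inf (x + y) = deg_inf x" "sgn_inf (x + y) = sgn_inf x"
proof -
  have "abs_inf x > 0"
    using assms(1) inf.nrm_nonneg[of x] by (simp add: less_le inf.nrm_eq_0_iff)
  then have "abs_inf ((1 + y / x) - 1) < 1"
    using assms by (simp add: inf.nrm_divide)
  then have u: "1 + y / x \<noteq> 0" "deg_inf (1 + y / x) = 0" "sgn_inf (1 + y / x) = 1"
    unfolding abs_inf_near_1_iff by auto
  have "x + y = x * (1 + y / x)"
    using assms by (simp add: field_simps)
  then show "x + y \<noteq> 0" "deg_inf (x + y) = deg_inf x" "sgn_inf (x + y) = sgn_inf x"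
    using u assms by (simp_all add: deg_inf_mult sgn_inf_mult)
qed

text \<open>The leading terms cancel; this is the descent in the reduction of elements to generators
  of the ideal.\<close>

lemma deg_inf_diff_less:
  assumes "x \<noteq> 0" "y \<noteq> 0" "deg_inf x = deg_inf y" "sgn_inf x = sgn_inf y" "x \<noteq> y"
  shows "deg_inf (x - y) < deg_inf y"
proof -
  have "abs_inf (x / y - 1) < 1"
    unfolding abs_inf_near_1_iff using assms
    by (simp add: divide_inverse deg_inf_mult sgn_inf_mult deg_inf_inverse sgn_inf_inverse)
  moreover have "x - y = (x / y - 1) * y"
    using assms by (simp add: field_simps)
  moreover have "abs_inf y > 0"
    using assms inf.nrm_nonneg[of y] by (simp add: less_le inf.nrm_eq_0_iff)
  ultimately have "abs_inf (x - y) < abs_inf y"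
    by (simp add: inf.nrm_mult)
  then show ?thesis
    using assms by (simp add: abs_inf_eq[of y] abs_inf_less_iff)
qed

lemma finite_degree_le: "finite {p :: 'a::finite_field poly. Polynomial.degree p \<le> n}"
proof (rule finite_subset)
  show "finite (Poly ` {xs :: 'a list. set xs \<subseteq> UNIV \<and> length xs \<le> Suc n})"
    by (intro finite_imageI finite_lists_length_le) simp
  show "{p. Polynomial.degree p \<le> n} \<subseteq> Poly ` {xs :: 'a list. set xs \<subseteq> UNIV \<and> length xs \<le> Suc n}"
  proof
    fix p :: "'a poly"
    assume "p \<in> {p. Polynomial.degree p \<le> n}"
    then have "length (coeffs p) \<le> Suc n"
      by (cases "p = 0") (simp_all add: length_coeffs_degree)
    then show "p \<in> Poly ` {xs :: 'a list. set xs \<subseteq> UNIV \<and> length xs \<le> Suc n}"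
      by (intro image_eqI[of _ _ "coeffs p"]) simp_all
  qed
qed

lemma of_A_conv_sum:
  assumes "Polynomial.degree p \<le> n"
  shows "of_A p = (\<Sum>j\<le>n. fls_const (Polynomial.coeff p j) * fls_X_inv ^ j)"
proof -
  have "of_A (\<Sum>j\<in>I. g j) = (\<Sum>j\<in>I. of_A (g j))" for I :: "nat set" and g :: "nat \<Rightarrow> 'a poly"
    by (induction I rule: infinite_finite_induct) (simp_all add: of_A_add)
  then show ?thesis
    using poly_as_sum_of_monoms'[OF assms] by (simp flip: of_A_monom) metis
qed

section \<open>The quadratic unit and conjugation on A[f]\<close>

locale quadratic_unit =
  fixes a :: "'a::finite_field poly" and b :: 'a and d :: nat and f :: "'a fls"
  assumes monic: "Polynomial.lead_coeff a = 1" and degree_a: "Polynomial.degree a = d"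
    and d_pos: "d \<ge> 1" and b_nonzero: "b \<noteq> 0"
    and quadratic: "f ^ 2 - of_A a * f - fls_const b = 0" and abs_f: "abs_inf f = real CARD('a) ^ d"
begin

text \<open>The second root of the quadratic polynomial, obtained from the sum of the roots.\<close>

definition f' :: "'a fls" where
  "f' = of_A a - f"

lemma f_nonzero: "f \<noteq> 0"
  using abs_f CARD_ge_2[where 'a = 'a] by auto

lemma deg_f: "deg_inf f = int d"
proof -
  have "real CARD('a) powi deg_inf f = real CARD('a) powi int d"
    using abs_f f_nonzero by (simp add: abs_inf_eq)
  then show ?thesis
    using CARD_powi_le_iff[where 'a = 'a] by (metis order_antisym order_refl)
qed

lemma f_mult_f': "f * f' = - fls_const b"
  using quadratic by (simp add: f'_def algebra_simps power2_eq_square)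

lemma f_square: "f * f = of_A a * f + fls_const b" "f' * f' = of_A a * f' + fls_const b"
  using quadratic by (simp_all add: f'_def algebra_simps power2_eq_square)

lemma f'_nonzero: "f' \<noteq> 0"
  using f_mult_f' b_nonzero by auto

lemma deg_f': "deg_inf f' = - int d"
proof -
  have "deg_inf (f * f') = 0"
    using b_nonzero unfolding f_mult_f' by (simp add: deg_inf_def)
  then show ?thesis
    using f_nonzero f'_nonzero by (simp add: deg_inf_mult deg_f)
qed

lemma abs_f'_less: "abs_inf f' < abs_inf f"
  using d_pos unfolding abs_inf_eq[OF f_nonzero] abs_inf_less_iff by (simp add: deg_f deg_f')

text \<open>\<open>f\<close> dominates the sum \<open>f + f'\<close>, which is the monic polynomial
  \<open>a\<close>.\<close>

lemma sgn_f: "sgn_inf f = 1"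
proof -
  have "sgn_inf (f + f') = sgn_inf f"
    using f_nonzero abs_f'_less by (rule add_smaller)
  then show ?thesis
    using monic by (simp add: f'_def sgn_inf_of_A)
qed

lemma f_minus_f': "f - f' \<noteq> 0" "deg_inf (f - f') = int d" "sgn_inf (f - f') = 1"
  using add_smaller[of f "- f'"] f_nonzero abs_f'_less by (auto simp: deg_f sgn_f)

text \<open>
  \<open>conj_rel u v\<close> says that \<open>v\<close> is the Galois conjugate of the element \<open>u\<close> of \<open>A[f]\<close>.
\<close>
definition conj_rel :: "'a fls \<Rightarrow> 'a fls \<Rightarrow> bool" where
  "conj_rel u v \<longleftrightarrow> (\<exists>x y. u = of_A x + of_A y * f \<and> v = of_A x + of_A y * f')"

lemma conj_relI: "conj_rel (of_A x + of_A y * f) (of_A x + of_A y * f')"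
  by (auto simp: conj_rel_def)

lemma conj_rel_of_A: "conj_rel (of_A x) (of_A x)"
  using conj_relI[of x 0] by simp

lemma conj_rel_const: "conj_rel (fls_const c) (fls_const c)"
  using conj_rel_of_A[of "[:c:]"] by (simp add: of_A_const)

lemma conj_rel_X_inv_power: "conj_rel (fls_X_inv ^ j) (fls_X_inv ^ j)"
  using conj_rel_of_A[of "Polynomial.monom 1 j"] by (simp add: of_A_monom)

lemma conj_rel_f: "conj_rel f f'"
  using conj_relI[of 0 1] by simp

lemma conj_rel_add:
  assumes "conj_rel u v" "conj_rel u' v'"
  shows "conj_rel (u + u') (v + v')"
proof -
  obtain x y x' y' where "u = of_A x + of_A y * f" "v = of_A x + of_A y * f'"
    "u' = of_A x' + of_A y' * f" "v' = of_A x' + of_A y' * f'"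
    using assms by (auto simp: conj_rel_def)
  then show ?thesis
    using conj_relI[of "x + x'" "y + y'"] by (simp add: of_A_add algebra_simps)
qed

text \<open>Both roots satisfy the same quadratic equation, so reducing the two products leads to
  the same coefficients \<open>?X\<close> and \<open>?Y\<close>.\<close>

lemma conj_rel_mult:
  assumes "conj_rel u v" "conj_rel u' v'"
  shows "conj_rel (u * u') (v * v')"
proof -
  obtain x y x' y' where eqs: "u = of_A x + of_A y * f" "v = of_A x + of_A y * f'"
    "u' = of_A x' + of_A y' * f" "v' = of_A x' + of_A y' * f'"
    using assms by (auto simp: conj_rel_def)
  let ?X = "x * x' + y * y' * [:b:]" and ?Y = "x * y' + y * x' + y * y' * a"
  have "u * u' = of_A x * of_A x' + (of_A x * of_A y' + of_A y * of_A x') * f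
      + of_A y * of_A y' * (f * f)"
    unfolding eqs by (simp add: algebra_simps)
  also have "\<dots> = of_A ?X + of_A ?Y * f"
    unfolding f_square of_A_add of_A_mult of_A_const by (simp add: algebra_simps)
  finally have u: "u * u' = of_A ?X + of_A ?Y * f" .
  have "v * v' = of_A x * of_A x' + (of_A x * of_A y' + of_A y * of_A x') * f'
      + of_A y * of_A y' * (f' * f')"
    unfolding eqs by (simp add: algebra_simps)
  also have "\<dots> = of_A ?X + of_A ?Y * f'"
    unfolding f_square of_A_add of_A_mult of_A_const by (simp add: algebra_simps)
  finally show ?thesis
    unfolding u by (simp only: conj_relI)
qed

lemma conj_rel_power: "conj_rel u v \<Longrightarrow> conj_rel (u ^ n) (v ^ n)"
proof (induction n)
  case 0
  then show ?case using conj_rel_of_A[of 1] by simp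
next
  case (Suc n)
  then show ?case by (simp add: conj_rel_mult)
qed

lemma conj_rel_diff:
  assumes "conj_rel u v" "conj_rel u' v'"
  shows "conj_rel (u - u') (v - v')"
  using conj_rel_add[OF assms(1) conj_rel_mult[OF conj_rel_const[of "- 1"] assms(2)]] by simp

text \<open>From \<open>f (f - a) = b\<close> the inverse of \<open>f\<close> is
  \<open>(f - a) / b\<close>, again in A[f], and the same formula holds for
  \<open>f'\<close>.\<close>

lemma conj_rel_inverse_f: "conj_rel (inverse f) (inverse f')"
proof -
  have "fls_const b * fls_const (inverse b) = 1"
    using b_nonzero by simp
  moreover have "f * (f - of_A a) = fls_const b" "f' * (f' - of_A a) = fls_const b"
    using f_square by (simp_all add: algebra_simps)
  ultimately have "f * ((f - of_A a) * fls_const (inverse b)) = 1"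
    "f' * ((f' - of_A a) * fls_const (inverse b)) = 1"
    by (metis mult.assoc)+
  then have "inverse f = (f - of_A a) * fls_const (inverse b)"
    "inverse f' = (f' - of_A a) * fls_const (inverse b)"
    by (simp_all add: inverse_unique)
  then show ?thesis
    by (metis conj_rel_const conj_rel_diff conj_rel_f conj_rel_mult conj_rel_of_A)
qed

text \<open>\<open>u = y (f - f') + v\<close>, where the first summand has absolute value at least 1
  and dominates. If \<open>y\<close> were 0, then \<open>u = v\<close> would be a polynomial smaller
  than 1, hence 0.\<close>

lemma conj_rel_small:
  assumes "conj_rel u v" "abs_inf v < 1" "u \<noteq> 0"
  obtains x y where "u = of_A x + of_A y * f" "v = of_A x + of_A y * f'" "y \<noteq> 0"
    "deg_inf u = int d + int (Polynomial.degree y)"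
proof -
  obtain x y where xy: "u = of_A x + of_A y * f" "v = of_A x + of_A y * f'"
    using assms(1) by (auto simp: conj_rel_def)
  have y: "y \<noteq> 0"
  proof
    assume "y = 0"
    with xy assms have "x = 0"
      by (intro of_A_abs_less_1) simp
    with \<open>y = 0\<close> xy assms(3) show False
      by simp
  qed
  let ?w = "of_A y * (f - f')"
  have w: "?w \<noteq> 0" "deg_inf ?w = int d + int (Polynomial.degree y)"
    using y f_minus_f' by (simp_all add: deg_inf_mult deg_inf_of_A)
  have "abs_inf v < abs_inf ?w"
  proof -
    have "1 \<le> abs_inf ?w"
      using w CARD_powi_le_iff[of 0 "deg_inf ?w", where 'a = 'a] by (simp add: abs_inf_eq)
    with assms(2) show ?thesis by linarith
  qed
  then have "deg_inf (?w + v) = deg_inf ?w"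
    using w(1) by (intro add_smaller)
  moreover have "?w + v = u"
    by (simp add: xy algebra_simps)
  ultimately show ?thesis
    using that[OF xy y] w(2) by simp
qed

text \<open>Two conjugates of one element differ by \<open>y (f - f')\<close>, which is 0 or of
  absolute value at least 1. This makes the function \<open>conjugate\<close> well defined.\<close>

lemma conj_rel_unique:
  assumes "conj_rel u v" "conj_rel u v'" "abs_inf v < 1" "abs_inf v' < 1"
  shows "v = v'"
proof -
  obtain x y where xy: "0 = of_A x + of_A y * f" "v - v' = of_A x + of_A y * f'"
    using conj_rel_diff[OF assms(1,2)] by (auto simp: conj_rel_def)
  have "v' - v = of_A y * (f - f')"
  proof -
    have "v' - v = (of_A x + of_A y * f) - (of_A x + of_A y * f')"
      unfolding xy[symmetric] by simp
    then show ?thesis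
      by (simp add: algebra_simps)
  qed
  moreover have "abs_inf (v' - v) < 1"
    using assms inf.nrm_diff_le[of v' v] by simp
  moreover have "1 \<le> abs_inf (of_A y * (f - f'))" if "y \<noteq> 0"
    using that f_minus_f' CARD_powi_le_iff[of 0 "deg_inf (of_A y * (f - f'))", where 'a = 'a]
    by (simp add: abs_inf_eq deg_inf_mult deg_inf_of_A)
  ultimately have "y = 0"
    by force
  with xy show ?thesis by simp
qed

section \<open>The ideals as sets of elements with small conjugate\<close>

definition conj_ideal :: "nat \<Rightarrow> 'a fls set" where
  "conj_ideal i = {u. \<exists>v. conj_rel u v \<and> abs_inf v \<le> real CARD('a) powi (int i - int d)}"

lemma conj_bound_less_1:
  assumes "i < d" "abs_inf v \<le> real CARD('a) powi (int i - int d)"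
  shows "abs_inf (v :: 'a fls) < 1"
  using assms abs_inf_less_iff[of v 0] unfolding abs_inf_le_iff by auto

text \<open>The conjugate of a generator \<open>f T^j\<close> has degree \<open>j - d < 0\<close>,
  and the bound 1 is stable under sums and products.\<close>

lemma A_inf1_conj:
  assumes "u \<in> A_inf1 f d"
  shows "\<exists>v. conj_rel u v \<and> abs_inf v \<le> 1"
  using assms
proof induction
  case (const c)
  then show ?case using conj_rel_const abs_inf_const_le by blast
next
  case (gen j)
  have "conj_rel (f * fls_X_inv ^ j) (f' * fls_X_inv ^ j)"
    by (intro conj_rel_mult conj_rel_f conj_rel_X_inv_power)
  moreover have "abs_inf (f' * fls_X_inv ^ j) \<le> 1"
    using gen f'_nonzero abs_inf_le_iff[of "f' * fls_X_inv ^ j" 0]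
    by (simp add: deg_inf_mult deg_f') (simp add: deg_inf_def)
  ultimately show ?case by blast
next
  case (add x y)
  then show ?case using conj_rel_add inf.nrm_add_bound by blast
next
  case (mult x y)
  then obtain v w where "conj_rel x v" "abs_inf v \<le> 1" "conj_rel y w" "abs_inf w \<le> 1"
    by blast
  then show ?case
    using conj_rel_mult[of x v y w] mult_mono[of "abs_inf v" 1 "abs_inf w" 1]
    by (auto simp: inf.nrm_mult inf.nrm_nonneg)
qed

lemma conj_ideal_add: "u \<in> conj_ideal i \<Longrightarrow> w \<in> conj_ideal i \<Longrightarrow> u + w \<in> conj_ideal i"
  unfolding conj_ideal_def using conj_rel_add inf.nrm_add_bound by blast

lemma conj_ideal_mult:
  assumes "u \<in> conj_ideal i" "conj_rel c c'" "abs_inf c' \<le> 1"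
  shows "c * u \<in> conj_ideal i"
proof -
  obtain v where v: "conj_rel u v" "abs_inf v \<le> real CARD('a) powi (int i - int d)"
    using assms(1) by (auto simp: conj_ideal_def)
  have "abs_inf (c' * v) \<le> 1 * real CARD('a) powi (int i - int d)"
    unfolding inf.nrm_mult using assms v by (intro mult_mono) (auto simp: inf.nrm_nonneg)
  then show ?thesis
    using conj_rel_mult[OF assms(2) v(1)] by (auto simp: conj_ideal_def)
qed

lemma conj_ideal_0: "0 \<in> conj_ideal i"
  using conj_rel_of_A[of 0] by (auto simp: conj_ideal_def intro: zero_le_power_int)

lemma conj_ideal_const_mult: "u \<in> conj_ideal i \<Longrightarrow> fls_const c * u \<in> conj_ideal i"
  using conj_ideal_mult conj_rel_const abs_inf_const_le by blast

lemma conj_ideal_diff: "u \<in> conj_ideal i \<Longrightarrow> w \<in> conj_ideal i \<Longrightarrow> u - w \<in> conj_ideal i"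
  using conj_ideal_add[of u i "fls_const (- 1) * w"] conj_ideal_const_mult[of w i "- 1"] by simp

lemma deg_power_X_inv:
  assumes "w \<noteq> 0"
  shows "deg_inf (w ^ m * fls_X_inv ^ j) = int m * deg_inf w + int j"
  using assms by (simp add: deg_inf_mult deg_inf_power) (simp add: deg_inf_def)

lemma generator_mem_conj_ideal: "j \<le> i \<Longrightarrow> f * fls_X_inv ^ j \<in> conj_ideal i"
proof -
  assume "j \<le> i"
  then have "abs_inf (f' * fls_X_inv ^ j) \<le> real CARD('a) powi (int i - int d)"
    unfolding abs_inf_le_iff using f'_nonzero deg_power_X_inv[of f' 1 j] by (simp add: deg_f')
  then show ?thesis
    unfolding conj_ideal_def using conj_rel_mult[OF conj_rel_f conj_rel_X_inv_power] by blast
qed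

text \<open>The conjugate has degree \<open>j - m d \<le> j - 2 d < - d\<close>. These elements lie
  in all the ideals and reach every degree from \<open>2 d\<close> on.\<close>

lemma power_mem_conj_ideal:
  assumes "m \<ge> 2" "j < d"
  shows "f ^ m * fls_X_inv ^ j \<in> conj_ideal i"
proof -
  have "int m * (- int d) \<le> - 2 * int d"
    using assms by (simp add: mult_right_mono)
  then have "abs_inf (f' ^ m * fls_X_inv ^ j) \<le> real CARD('a) powi (int i - int d)"
    unfolding abs_inf_le_iff deg_power_X_inv[OF f'_nonzero] deg_f' using assms(2) by linarith
  then show ?thesis
    unfolding conj_ideal_def
    using conj_rel_mult[OF conj_rel_power[OF conj_rel_f] conj_rel_X_inv_power] by blast
qed

lemma A_inf1_0: "0 \<in> A_inf1 f d" and A_inf1_1: "1 \<in> A_inf1 f d"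
  using A_inf1.const[of 0] A_inf1.const[of 1] by simp_all

lemma A_inf1_power: "f ^ n \<in> A_inf1 f d"
proof (induction n)
  case (Suc n)
  have "f * fls_X_inv ^ 0 \<in> A_inf1 f d"
    using d_pos by (intro A_inf1.gen) simp
  with Suc show ?case by (simp add: A_inf1.mult)
qed (simp add: A_inf1_1)

lemma ideal_a_add:
  assumes "u \<in> ideal_a f d i" "w \<in> ideal_a f d i"
  shows "u + w \<in> ideal_a f d i"
proof -
  obtain c c' where "u = (\<Sum>j\<le>i. c j * (f * fls_X_inv ^ j))" "\<forall>j\<le>i. c j \<in> A_inf1 f d"
    "w = (\<Sum>j\<le>i. c' j * (f * fls_X_inv ^ j))" "\<forall>j\<le>i. c' j \<in> A_inf1 f d"
    using assms by (auto simp: ideal_a_def)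
  then show ?thesis
    unfolding ideal_a_def
    by (intro CollectI exI[of _ "\<lambda>j. c j + c' j"])
      (auto simp: sum.distrib distrib_right intro: A_inf1.add)
qed

lemma ideal_a_generator_mult:
  assumes "c \<in> A_inf1 f d" "j \<le> i"
  shows "c * (f * fls_X_inv ^ j) \<in> ideal_a f d i"
  unfolding ideal_a_def
proof (intro CollectI exI[of _ "\<lambda>k. if k = j then c else 0"] conjI)
  show "c * (f * fls_X_inv ^ j) = (\<Sum>k\<le>i. (if k = j then c else 0) * (f * fls_X_inv ^ k))"
    using assms(2) by (simp add: if_distrib[of "\<lambda>c. c * _"] sum.delta cong: if_cong)
qed (use assms(1) A_inf1_0 in auto)

lemma ideal_a_subset_conj_ideal: "ideal_a f d i \<subseteq> conj_ideal i"
proof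
  fix u assume "u \<in> ideal_a f d i"
  then obtain c where u: "u = (\<Sum>j\<le>i. c j * (f * fls_X_inv ^ j))" "\<forall>j\<le>i. c j \<in> A_inf1 f d"
    by (auto simp: ideal_a_def)
  have "(\<Sum>j\<in>J. c j * (f * fls_X_inv ^ j)) \<in> conj_ideal i" if "finite J" "J \<subseteq> {..i}" for J
    using that
  proof (induction J rule: finite_induct)
    case (insert j J)
    then have "c j * (f * fls_X_inv ^ j) \<in> conj_ideal i"
      using u(2) A_inf1_conj[of "c j"] generator_mem_conj_ideal[of j i]
      by (auto intro: conj_ideal_mult)
    with insert show ?case
      by (auto intro: conj_ideal_add)
  qed (simp add: conj_ideal_0)
  then show "u \<in> conj_ideal i"
    by (simp add: u(1))
qed

text \<open>
  An element of degree at least \<open>2 d\<close> is reduced by a constant multiple of the \<open>f\<^bsup>m\<^esup> T\<^bsup>j\<^esup>\<close>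
  with \<open>m \<ge> 2\<close> and \<open>j < d\<close> of the same degree; the remaining ones are combinations of the generators.
\<close>
lemma conj_ideal_subset_ideal_a:
  assumes "i < d" "u \<in> conj_ideal i"
  shows "u \<in> ideal_a f d i"
  using assms(2)
proof (induction "nat (deg_inf u)" arbitrary: u rule: less_induct)
  case less
  have zero: "0 \<in> ideal_a f d i"
    using ideal_a_generator_mult[OF A_inf1_0, of 0 i] by simp
  show ?case
  proof (cases "u = 0")
    case False
    obtain v where v: "conj_rel u v" "abs_inf v \<le> real CARD('a) powi (int i - int d)"
      using less.prems by (auto simp: conj_ideal_def)
    then have v1: "abs_inf v < 1"
      using conj_bound_less_1[OF assms(1)] by blast
    obtain x y where xy: "u = of_A x + of_A y * f" "v = of_A x + of_A y * f'" "y \<noteq> 0"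
      and deg: "deg_inf u = int d + int (Polynomial.degree y)"
      using conj_rel_small[OF v(1) v1 False] by blast
    show ?thesis
    proof (cases "Polynomial.degree y < d")
      \<comment> \<open>Here \<open>y f'\<close> is smaller than 1, so the polynomial
        \<open>x = v - y f'\<close> is 0. Thus \<open>u = y f\<close>, and the bound on the
        conjugate becomes \<open>degree y \<le> i\<close>.\<close>
      case True
      have "abs_inf (of_A y * f') < real CARD('a) powi 0"
        unfolding abs_inf_less_iff using True xy(3) f'_nonzero
        by (simp add: deg_inf_mult deg_inf_of_A deg_f')
      then have "abs_inf (v - of_A y * f') < 1"
        using v1 inf.nrm_diff_le[of v "of_A y * f'"] by simp
      then have x: "x = 0"
        using xy(2) by (intro of_A_abs_less_1) simp
      then have "abs_inf (of_A y * f') \<le> real CARD('a) powi (int i - int d)"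
        using v(2) xy(2) by simp
      then have "Polynomial.degree y \<le> i"
        unfolding abs_inf_le_iff using xy(3) f'_nonzero
        by (simp add: deg_inf_mult deg_inf_of_A deg_f')
      then have "u = (\<Sum>j\<le>i. fls_const (Polynomial.coeff y j) * (f * fls_X_inv ^ j))"
        unfolding xy(1) x by (simp add: of_A_conv_sum sum_distrib_left mult_ac)
      then show ?thesis
        unfolding ideal_a_def
        by (intro CollectI exI[of _ "\<lambda>j. fls_const (Polynomial.coeff y j)"])
          (simp add: A_inf1.const)
    next
      case ge: False
      \<comment> \<open>Since \<open>deg u = d + degree y\<close>, division of
        \<open>degree y\<close> by \<open>d\<close> makes \<open>f^(m+1) T^j\<close> an element of
        the degree of \<open>u\<close>; \<open>m \<ge> 1\<close> gives an exponent of at least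
        2.\<close>
      define m where "m = Polynomial.degree y div d"
      define j where "j = Polynomial.degree y mod d"
      have m: "m \<ge> 1" and j: "j < d"
        using ge d_pos by (auto simp: m_def j_def div_greater_zero_iff Suc_le_eq)
      have deg': "deg_inf u = int (Suc m) * int d + int j"
        unfolding deg m_def j_def by (simp add: algebra_simps flip: of_nat_mult of_nat_add)
      define w where "w = fls_const (sgn_inf u) * (f ^ Suc m * fls_X_inv ^ j)"
      have sgn_u: "sgn_inf u \<noteq> 0"
        using False by simp
      have w0: "f ^ Suc m * fls_X_inv ^ j \<noteq> 0"
        using f_nonzero by simp
      have w: "w \<noteq> 0" "deg_inf w = deg_inf u" "sgn_inf w = sgn_inf u"
      proof -
        show "w \<noteq> 0"
          using w0 sgn_u by (simp add: w_def)
        show "deg_inf w = deg_inf u"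
          using w0 sgn_u unfolding w_def deg'
          by (subst deg_inf_mult) (simp_all add: deg_power_X_inv[OF f_nonzero] deg_f del: power_Suc)
        have "sgn_inf (fls_X_inv :: 'a fls) = 1"
          by (simp add: sgn_inf_def)
        then show "sgn_inf w = sgn_inf u"
          by (simp add: w_def sgn_inf_mult sgn_inf_power sgn_f)
      qed
      have "w \<in> conj_ideal i"
        unfolding w_def using m j by (intro conj_ideal_const_mult power_mem_conj_ideal) auto
      then have diff: "u - w \<in> conj_ideal i"
        using less.prems by (rule conj_ideal_diff[rotated])
      have w_mem: "w \<in> ideal_a f d i"
      proof -
        \<comment> \<open>One factor \<open>f\<close> is split off as the generator with index 0;
          the second one is used to form \<open>f T^j\<close>, which lies in the ring.\<close>
        have "fls_const (sgn_inf u) * (f ^ (m - 1) * (f * fls_X_inv ^ j)) \<in> A_inf1 f d"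
          using j by (intro A_inf1.mult A_inf1.const A_inf1_power A_inf1.gen)
        then have "fls_const (sgn_inf u) * (f ^ (m - 1) * (f * fls_X_inv ^ j)) * (f * fls_X_inv ^ 0) \<in> ideal_a f d i"
          by (intro ideal_a_generator_mult) auto
        moreover have "f ^ Suc m = f * f * f ^ (m - 1)"
          using m by (cases m) auto
        ultimately show ?thesis
          unfolding w_def by (simp only: power_0 mult_1_right mult_1_left mult_ac)
      qed
      have "u - w \<in> ideal_a f d i"
      proof (cases "u = w")
        case True
        with zero show ?thesis by simp
      next
        case neq: False
        then have "deg_inf (u - w) < deg_inf u"
          using deg_inf_diff_less[of u w] False w by simp
        then show ?thesis
          using diff deg d_pos by (intro less.hyps) auto
      qed
      with w_mem show ?thesis
        using ideal_a_add[of "u - w" i w] by simp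
    qed
  qed (simp add: zero)
qed

lemma ideal_a_eq: "i < d \<Longrightarrow> ideal_a f d i = conj_ideal i"
  using ideal_a_subset_conj_ideal conj_ideal_subset_ideal_a by blast

text \<open>Finiteness: for nonzero \<open>u = x + y f\<close> the degree of \<open>u\<close> bounds
  that of \<open>y\<close>, and the small conjugate \<open>x + y f'\<close> then bounds
  \<open>x\<close>. Large degrees are reached by the elements \<open>f^m T^j\<close>.\<close>

lemma conj_ideal_lattice:
  assumes i: "i < d"
  shows "fq_lattice (conj_ideal i)"
proof
  have nz: "\<exists>x y v. u = of_A x + of_A y * f \<and> v = of_A x + of_A y * f' \<and> y \<noteq> 0 \<and> abs_inf v < 1 \<and>
      deg_inf u = int d + int (Polynomial.degree y)" if u: "u \<in> conj_ideal i" "u \<noteq> 0" for u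
  proof -
    obtain v where v: "conj_rel u v" "abs_inf v \<le> real CARD('a) powi (int i - int d)"
      using u by (auto simp: conj_ideal_def)
    then have "abs_inf v < 1"
      using conj_bound_less_1[OF i] by blast
    with conj_rel_small[OF v(1) this u(2)] show ?thesis
      by metis
  qed
  show "0 \<in> conj_ideal i"
    by (rule conj_ideal_0)
  show "x + y \<in> conj_ideal i" if "x \<in> conj_ideal i" "y \<in> conj_ideal i" for x y
    using that by (rule conj_ideal_add)
  show "fls_const c * x \<in> conj_ideal i" if "x \<in> conj_ideal i" for x c
    using that by (rule conj_ideal_const_mult)
  show "0 \<le> deg_inf x" if "x \<in> conj_ideal i" for x
    using nz[OF that] by (cases "x = 0") (auto simp: deg_inf_def)
  show "finite {x \<in> conj_ideal i. deg_inf x < n}" for n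
  proof (rule finite_subset)
    let ?D = "{p :: 'a poly. Polynomial.degree p \<le> nat n}"
    show "finite (insert 0 ((\<lambda>(x, y). of_A x + of_A y * f) ` (?D \<times> ?D)))"
      using finite_degree_le by blast
    show "{x \<in> conj_ideal i. deg_inf x < n} \<subseteq> insert 0 ((\<lambda>(x, y). of_A x + of_A y * f) ` (?D \<times> ?D))"
    proof
      fix u assume u: "u \<in> {x \<in> conj_ideal i. deg_inf x < n}"
      show "u \<in> insert 0 ((\<lambda>(x, y). of_A x + of_A y * f) ` (?D \<times> ?D))"
      proof (cases "u = 0")
        case False
        then obtain x y v where xy: "u = of_A x + of_A y * f" "v = of_A x + of_A y * f'" "y \<noteq> 0"
          "abs_inf v < 1" "deg_inf u = int d + int (Polynomial.degree y)"
          using nz u by blast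
        then have y: "int (Polynomial.degree y) \<le> n" "n \<ge> 0"
          using u by auto
        have "abs_inf (of_A y * f') \<le> real CARD('a) powi n"
          unfolding abs_inf_le_iff using y xy(3) f'_nonzero
          by (simp add: deg_inf_mult deg_inf_of_A deg_f')
        moreover have "abs_inf v \<le> real CARD('a) powi n"
        proof -
          have "1 \<le> real CARD('a) powi n"
            using y(2) CARD_powi_le_iff[of 0 n, where 'a = 'a] by (simp only: power_int_0_right)
          with xy(4) show ?thesis
            by linarith
        qed
        ultimately have "abs_inf (v - of_A y * f') \<le> real CARD('a) powi n"
          by (rule inf.nrm_diff_bound[rotated])
        then have "abs_inf (of_A x) \<le> real CARD('a) powi n"
          using xy(2) by simp
        then have "x \<in> ?D"
          unfolding abs_inf_le_iff using y(2) by (auto simp: deg_inf_of_A)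
        moreover have "y \<in> ?D"
          using y by simp
        ultimately show ?thesis
          using xy(1) by (intro insertI2 image_eqI[of _ _ "(x, y)"]) auto
      qed simp
    qed
  qed
  have "deg_slice (conj_ideal i) M \<noteq> {}" if "M \<ge> 2 * d" for M
  proof -
    have "M div d \<ge> 2"
      using that d_pos by (simp add: less_eq_div_iff_mult_less_eq)
    moreover have "deg_inf (f ^ (M div d) * fls_X_inv ^ (M mod d)) = int M"
      unfolding deg_power_X_inv[OF f_nonzero] deg_f
      by (simp flip: of_nat_mult of_nat_add)
    ultimately have "f ^ (M div d) * fls_X_inv ^ (M mod d) \<in> deg_slice (conj_ideal i) M"
      using d_pos f_nonzero by (auto simp: deg_slice_def intro: power_mem_conj_ideal)
    then show ?thesis
      by blast
  qed
  then show "\<forall>\<^sub>F M in sequentially. deg_slice (conj_ideal i) M \<noteq> {}"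
    unfolding eventually_sequentially by blast
qed

end

section \<open>Diophantine approximation of the quadratic unit\<close>

text \<open>Absolute values are powers of q, so the strict bound is the same for all \<epsilon>
  above \<open>q^(-k-1)\<close> and up to \<open>q^(-k)\<close>.\<close>

lemma Lambda_eps_cong:
  fixes f :: "'a::finite_field fls"
  assumes "real CARD('a) powi (- int (Suc k)) < \<epsilon>" "\<epsilon> \<le> real CARD('a) powi (- int k)"
  shows "Lambda_eps f \<epsilon> = Lambda_eps f (real CARD('a) powi (- int k))"
proof -
  have "abs_inf x < \<epsilon> \<longleftrightarrow> abs_inf x < real CARD('a) powi (- int k)" for x :: "'a fls"
  proof
    assume "abs_inf x < real CARD('a) powi (- int k)"
    then have "abs_inf x \<le> real CARD('a) powi (- int (Suc k))"
      unfolding abs_inf_less_iff abs_inf_le_iff by auto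
    with assms(1) show "abs_inf x < \<epsilon>"
      by linarith
  qed (use assms(2) in linarith)
  then show ?thesis
    by (simp add: Lambda_eps_def)
qed

context quadratic_unit
begin

definition conjugate :: "'a fls \<Rightarrow> 'a fls" where
  "conjugate u = (THE v. conj_rel u v \<and> abs_inf v < 1)"

lemma conjugate_eqI: "conj_rel u v \<Longrightarrow> abs_inf v < 1 \<Longrightarrow> conjugate u = v"
  unfolding conjugate_def using conj_rel_unique by blast

lemma conjugate_props:
  assumes "i < d" "u \<in> conj_ideal i"
  shows "conj_rel u (conjugate u)" "abs_inf (conjugate u) \<le> real CARD('a) powi (int i - int d)"
    "abs_inf (conjugate u) < 1"
proof -
  obtain v where v: "conj_rel u v" "abs_inf v \<le> real CARD('a) powi (int i - int d)"
    using assms by (auto simp: conj_ideal_def)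
  moreover have "abs_inf v < 1"
    using conj_bound_less_1 assms(1) v(2) by blast
  moreover from v(1) this have "conjugate u = v"
    by (rule conjugate_eqI)
  ultimately show "conj_rel u (conjugate u)" "abs_inf (conjugate u) \<le> real CARD('a) powi (int i - int d)"
    "abs_inf (conjugate u) < 1"
    by simp_all
qed

lemma conjugate_0: "conjugate 0 = 0"
  using conj_rel_of_A[of 0] by (intro conjugate_eqI) auto

lemma conjugate_diff:
  assumes "i < d" "u \<in> conj_ideal i" "w \<in> conj_ideal i"
  shows "conjugate (u - w) = conjugate u - conjugate w"
  using assms conjugate_props[of i u] conjugate_props[of i w] inf.nrm_diff_le[of "conjugate u" "conjugate w"]
  by (intro conjugate_eqI conj_rel_diff) auto

text \<open>
  Multiplication by \<open>f\<^bsup>n\<^esup>\<close> makes the conjugate small; \<open>denom n u\<close> is the coefficient of \<open>f\<close> in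
  \<open>f\<^bsup>n\<^esup> u\<close>.
\<close>
definition denom :: "nat \<Rightarrow> 'a fls \<Rightarrow> 'a fls" where
  "denom n u = (f ^ n * u - f' ^ n * conjugate u) / (f - f')"

lemma denom_eqI:
  assumes "f ^ n * u = of_A x + of_A y * f" "f' ^ n * conjugate u = of_A x + of_A y * f'"
  shows "denom n u = of_A y"
  using f_minus_f'(1) unfolding denom_def assms by (simp add: field_simps)

lemma deg_inf_conj_ideal_nonneg: "i < d \<Longrightarrow> u \<in> conj_ideal i \<Longrightarrow> 0 \<le> deg_inf u"
  using fq_lattice.deg_nonneg[OF conj_ideal_lattice] by blast

text \<open>The relative error is \<open>- (f'/f)^n * (u'/u)\<close> with \<open>u'\<close> the
  conjugate, and \<open>|u'| < 1 \<le> |u|\<close> makes the bound uniform in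
  \<open>u\<close>.\<close>

lemma denom_near:
  assumes "i < d" "u \<in> conj_ideal i" "u \<noteq> 0"
  shows "abs_inf (denom n u / (f ^ n / (f - f') * u) - 1) \<le> real CARD('a) powi (- int n)"
proof -
  have "denom n u / (f ^ n / (f - f') * u) - 1 = - ((f' / f) ^ n * (conjugate u / u))"
    using f_minus_f'(1) f_nonzero assms(3)
    by (simp add: denom_def divide_simps)
  moreover have "abs_inf (f' / f) \<le> real CARD('a) powi (- 1)"
    unfolding abs_inf_le_iff using f_nonzero f'_nonzero d_pos
    by (simp add: divide_inverse deg_inf_mult deg_inf_inverse deg_f deg_f')
  then have "abs_inf (f' / f) ^ n \<le> (real CARD('a) powi (- 1)) ^ n"
    by (intro power_mono inf.nrm_nonneg)
  moreover have "(real CARD('a) powi (- 1)) ^ n = real CARD('a) powi (- int n)"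
    by (simp add: power_int_minus power_inverse)
  moreover have "abs_inf (conjugate u / u) \<le> 1"
  proof -
    have "1 \<le> abs_inf u"
      using deg_inf_conj_ideal_nonneg[OF assms(1,2)] assms(3)
        CARD_powi_le_iff[of 0 "deg_inf u", where 'a = 'a] by (simp add: abs_inf_eq)
    then show ?thesis
      using conjugate_props(3)[OF assms(1,2)] by (simp add: inf.nrm_divide divide_simps)
  qed
  ultimately show ?thesis
    using mult_mono[of "abs_inf (f' / f) ^ n" "real CARD('a) powi (- int n)" "abs_inf (conjugate u / u)" 1]
      CARD_powi_pos[of "- int n", where 'a = 'a]
    by (simp add: inf.nrm_mult inf.nrm_power inf.nrm_nonneg del: times_divide_eq_right)
qed

lemma denom_nonzero:
  assumes "i < d" "u \<in> conj_ideal i" "u \<noteq> 0" "n \<ge> 1"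
  shows "denom n u \<noteq> 0" "deg_inf (denom n u) = deg_inf u + int (d * (n - 1))"
proof -
  let ?g = "f ^ n / (f - f')"
  have "real CARD('a) powi (- int n) < 1"
    using assms(4) CARD_powi_le_iff[of 0 "- int n", where 'a = 'a] by (simp flip: not_le)
  then have "abs_inf (denom n u / (?g * u) - 1) < 1"
    using denom_near[OF assms(1-3), of n] by linarith
  then have r: "denom n u / (?g * u) \<noteq> 0" "deg_inf (denom n u / (?g * u)) = 0"
    unfolding abs_inf_near_1_iff by auto
  then show nz: "denom n u \<noteq> 0"
    by auto
  have g: "?g \<noteq> 0" "deg_inf ?g = int (d * (n - 1))"
    using f_nonzero f_minus_f' assms(4)
    by (simp_all add: divide_inverse deg_inf_mult deg_inf_inverse deg_inf_power deg_f of_nat_diff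
        algebra_simps)
  have "denom n u = denom n u / (?g * u) * (?g * u)"
    using g assms(3) by simp
  then have "deg_inf (denom n u) = deg_inf (denom n u / (?g * u) * (?g * u))"
    by simp
  also have "\<dots> = deg_inf (denom n u / (?g * u)) + (deg_inf ?g + deg_inf u)"
    using r(1) g(1) assms(3) by (simp only: deg_inf_mult mult_eq_0_iff simp_thms)
  finally show "deg_inf (denom n u) = deg_inf u + int (d * (n - 1))"
    unfolding r(2) g(2) by simp
qed

lemma denom_diff:
  assumes "i < d" "u \<in> conj_ideal i" "w \<in> conj_ideal i"
  shows "denom n (u - w) = denom n u - denom n w"
proof -
  have "f ^ n * (u - w) - f' ^ n * (conjugate u - conjugate w) =
      (f ^ n * u - f' ^ n * conjugate u) - (f ^ n * w - f' ^ n * conjugate w)"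
    by (simp add: algebra_simps)
  then show ?thesis
    unfolding denom_def conjugate_diff[OF assms] by (simp only: diff_divide_distrib)
qed

text \<open>Write \<open>f^n u = x0 + y f\<close>; its conjugate is up to sign the approximation
  error of \<open>y\<close>. As \<open>|f'^n| = q^(-dn)\<close>, the condition
  \<open>|u'| \<le> q^(-l-1)\<close> for the ideal with index \<open>d - 1 - l\<close> is the strict
  bound by \<open>q^(-dn-l)\<close>. Surjectivity uses that \<open>f\<close> is a unit.\<close>

lemma denom_bij:
  assumes "l < d" "n \<ge> 1"
  shows "bij_betw (denom n) (conj_ideal (d - 1 - l))
    (Lambda_eps f (real CARD('a) powi (- int (d * n + l))))"
  unfolding bij_betw_def
proof (intro conjI equalityI subsetI)
  define i where "i = d - 1 - l"
  have i: "i < d" "int i - int d = - int l - 1"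
    using assms by (auto simp: i_def)
  let ?\<epsilon> = "real CARD('a) powi (- int (d * n + l))"
  show "inj_on (denom n) (conj_ideal (d - 1 - l))"
    unfolding i_def[symmetric]
  proof (rule inj_onI)
    fix u w assume uw: "u \<in> conj_ideal i" "w \<in> conj_ideal i" "denom n u = denom n w"
    then have "denom n (u - w) = 0"
      using denom_diff[OF i(1)] by simp
    with denom_nonzero(1)[OF i(1) conj_ideal_diff[OF uw(1,2)] _ assms(2)] show "u = w"
      by auto
  qed
  fix x assume "x \<in> denom n ` conj_ideal (d - 1 - l)"
  then obtain u where u: "u \<in> conj_ideal i" "x = denom n u"
    by (auto simp: i_def)
  have "conj_rel (f ^ n * u) (f' ^ n * conjugate u)"
    using conjugate_props(1)[OF i(1) u(1)] conj_rel_f by (intro conj_rel_mult conj_rel_power)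
  then obtain x0 y where xy: "f ^ n * u = of_A x0 + of_A y * f" "f' ^ n * conjugate u = of_A x0 + of_A y * f'"
    by (auto simp: conj_rel_def)
  \<comment> \<open>The approximating polynomial \<open>y a + x0\<close> arises from replacing
    \<open>f\<close> by \<open>a - f'\<close>.\<close>
  have "of_A y * f - of_A (y * a + x0) = - (f' ^ n * conjugate u)"
    unfolding xy(2) by (simp add: of_A_add of_A_mult f'_def algebra_simps)
  moreover have "abs_inf (f' ^ n * conjugate u) < ?\<epsilon>"
  proof -
    have "conjugate u = 0 \<or> deg_inf (conjugate u) \<le> - int l - 1"
      using conjugate_props(2)[OF i(1) u(1)] unfolding abs_inf_le_iff i(2) by auto
    then show ?thesis
      unfolding abs_inf_less_iff using f'_nonzero
      by (cases "conjugate u = 0") (auto simp: deg_inf_mult deg_inf_power deg_f' algebra_simps)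
  qed
  ultimately have "abs_inf (of_A y * f - of_A (y * a + x0)) < ?\<epsilon>"
    by simp
  then show "x \<in> Lambda_eps f ?\<epsilon>"
    unfolding Lambda_eps_def u(2) denom_eqI[OF xy] by blast
next
  define i where "i = d - 1 - l"
  have i: "i < d" "int i - int d = - int l - 1"
    using assms by (auto simp: i_def)
  let ?\<epsilon> = "real CARD('a) powi (- int (d * n + l))"
  fix x assume "x \<in> Lambda_eps f ?\<epsilon>"
  then obtain y w where x: "x = of_A y" and w: "abs_inf (of_A y * f - of_A w) < ?\<epsilon>"
    by (auto simp: Lambda_eps_def)
  \<comment> \<open>Chosen so that \<open>x0 + y f'\<close> is the negative of the given
    approximation error; division by \<open>f'^n\<close> then yields the conjugate of the preimage
    \<open>u\<close>.\<close>
  define x0 where "x0 = w - y * a"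
  define v where "v = of_A x0 + of_A y * f'"
  have "v = - (of_A y * f - of_A w)"
    by (simp add: v_def x0_def of_A_diff of_A_mult f'_def algebra_simps)
  with w have v: "abs_inf v < ?\<epsilon>"
    by (simp only: inf.nrm_minus)
  define u where "u = inverse f ^ n * (of_A x0 + of_A y * f)"
  have rel: "conj_rel u (inverse f' ^ n * v)"
    unfolding u_def v_def by (intro conj_rel_mult conj_rel_power conj_rel_inverse_f conj_relI)
  have small: "abs_inf (inverse f' ^ n * v) \<le> real CARD('a) powi (int i - int d)"
  proof -
    have "v = 0 \<or> deg_inf v < - int (d * n + l)"
      using v unfolding abs_inf_less_iff .
    then show ?thesis
      unfolding abs_inf_le_iff i(2) using f'_nonzero
      by (cases "v = 0") (auto simp: deg_inf_mult deg_inf_power deg_inf_inverse deg_f' algebra_simps)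
  qed
  have "conjugate u = inverse f' ^ n * v"
    using rel conj_bound_less_1[OF i(1) small] by (rule conjugate_eqI)
  then have "f' ^ n * conjugate u = of_A x0 + of_A y * f'" "f ^ n * u = of_A x0 + of_A y * f"
    using f_nonzero f'_nonzero by (simp_all add: u_def v_def power_inverse)
  then have "denom n u = x"
    unfolding x by (rule denom_eqI[rotated])
  moreover have "u \<in> conj_ideal i"
    using rel small by (auto simp: conj_ideal_def)
  ultimately show "x \<in> denom n ` conj_ideal (d - 1 - l)"
    by (auto simp: i_def)
qed

lemma Lambda_eps_lattice:
  assumes "l < d" "n \<ge> 1"
  shows "fq_lattice (Lambda_eps f (real CARD('a) powi (- int (d * n + l))))" (is "fq_lattice ?\<Lambda>")
proof
  let ?\<epsilon> = "real CARD('a) powi (- int (d * n + l))"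
  show "0 \<in> ?\<Lambda>"
    unfolding Lambda_eps_def using CARD_powi_pos[where 'a = 'a]
    by (intro CollectI exI[of _ 0] conjI exI[of _ 0]) auto
  show "x + y \<in> ?\<Lambda>" if xy: "x \<in> ?\<Lambda>" "y \<in> ?\<Lambda>" for x y
  proof -
    obtain p r p' r' where *: "x = of_A p" "abs_inf (of_A p * f - of_A r) < ?\<epsilon>"
      "y = of_A p'" "abs_inf (of_A p' * f - of_A r') < ?\<epsilon>"
      using xy unfolding Lambda_eps_def by blast
    have "of_A (p + p') * f - of_A (r + r') = (of_A p * f - of_A r) + (of_A p' * f - of_A r')"
      by (simp add: of_A_add algebra_simps)
    then have "abs_inf (of_A (p + p') * f - of_A (r + r')) < ?\<epsilon>"
      using * inf.nrm_add_le[of "of_A p * f - of_A r" "of_A p' * f - of_A r'"] by simp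
    then show ?thesis
      unfolding Lambda_eps_def * of_A_add[symmetric] by blast
  qed
  show "fls_const c * x \<in> ?\<Lambda>" if x: "x \<in> ?\<Lambda>" for x c
  proof -
    obtain p r where *: "x = of_A p" "abs_inf (of_A p * f - of_A r) < ?\<epsilon>"
      using x unfolding Lambda_eps_def by blast
    have "of_A (Polynomial.smult c p) * f - of_A (Polynomial.smult c r) =
        fls_const c * (of_A p * f - of_A r)"
      by (simp add: of_A_smult algebra_simps)
    moreover have "abs_inf (fls_const c * (of_A p * f - of_A r)) \<le> 1 * abs_inf (of_A p * f - of_A r)"
      unfolding inf.nrm_mult by (intro mult_right_mono abs_inf_const_le inf.nrm_nonneg)
    ultimately have "abs_inf (of_A (Polynomial.smult c p) * f - of_A (Polynomial.smult c r)) < ?\<epsilon>"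
      using *(2) by simp
    then show ?thesis
      unfolding Lambda_eps_def * of_A_smult[symmetric] by blast
  qed
  show "0 \<le> deg_inf x" if "x \<in> ?\<Lambda>" for x
    using that by (auto simp: Lambda_eps_def deg_inf_of_A)
  show "finite {x \<in> ?\<Lambda>. deg_inf x < m}" for m
    by (rule finite_subset[OF _ finite_imageI[OF finite_degree_le[of "nat m"], of of_A]])
      (auto simp: Lambda_eps_def deg_inf_of_A)
  let ?i = "d - 1 - l"
  have i: "?i < d"
    using assms by simp
  obtain M0 where M0: "\<And>M. M \<ge> M0 \<Longrightarrow> deg_slice (conj_ideal ?i) M \<noteq> {}"
    using fq_lattice.eventually_deg_slice[OF conj_ideal_lattice[OF i]]
    by (auto simp: eventually_sequentially)
  \<comment> \<open>Elements of large degree are carried over from the ideal by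
    \<open>denom n\<close>, which raises degrees by \<open>d (n - 1)\<close>.\<close>
  have "deg_slice ?\<Lambda> M \<noteq> {}" if M: "M \<ge> M0 + d * (n - 1)" for M
  proof -
    have "M - d * (n - 1) \<ge> M0"
      using M by simp
    from M0[OF this] obtain u where u: "u \<in> conj_ideal ?i" "u \<noteq> 0" "deg_inf u = int (M - d * (n - 1))"
      unfolding deg_slice_def by blast
    have "denom n u \<in> ?\<Lambda>"
      using denom_bij[OF assms] u(1) by (auto simp: bij_betw_def)
    moreover have "denom n u \<noteq> 0" "deg_inf (denom n u) = int M"
      using denom_nonzero[OF i u(1,2) assms(2)] u(3) M by (simp_all del: of_nat_mult)
    ultimately show ?thesis
      by (auto simp: deg_slice_def)
  qed
  then show "\<forall>\<^sub>F M in sequentially. deg_slice ?\<Lambda> M \<noteq> {}"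
    unfolding eventually_sequentially by blast
qed

lemma denom_perturbation:
  assumes "uniformizer \<pi>" "l < d" "n \<ge> 1"
  shows "perturbation (conj_ideal (d - 1 - l))
    (Lambda_eps f (real CARD('a) powi (- int (d * n + l)))) \<pi>
    (denom n) (f ^ n / (f - f')) (d * (n - 1)) (real CARD('a) powi (- int n))"
proof (intro perturbation.intro fq_lattice_uniformizer.intro perturbation_axioms.intro)
  have i: "d - 1 - l < d"
    using assms by simp
  show "fq_lattice (conj_ideal (d - 1 - l))"
    using i by (rule conj_ideal_lattice)
  show "fq_lattice (Lambda_eps f (real CARD('a) powi (- int (d * n + l))))"
    using assms(2,3) by (rule Lambda_eps_lattice)
  show "bij_betw (denom n) (conj_ideal (d - 1 - l))
      (Lambda_eps f (real CARD('a) powi (- int (d * n + l))))"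
    using assms(2,3) by (rule denom_bij)
  show "denom n 0 = 0"
    by (simp add: denom_def conjugate_0)
  show "f ^ n / (f - f') \<noteq> 0"
    using f_nonzero f_minus_f' by simp
  show "deg_inf (f ^ n / (f - f')) = int (d * (n - 1))"
    using f_nonzero f_minus_f' assms(3)
    by (simp add: divide_inverse deg_inf_mult deg_inf_inverse deg_inf_power deg_f of_nat_diff
        algebra_simps)
  show "sgn_inf (f ^ n / (f - f')) = 1"
    using f_minus_f' by (simp add: divide_inverse sgn_inf_mult sgn_inf_inverse sgn_inf_power sgn_f)
  show "0 < real CARD('a) powi (- int n)"
    by (rule CARD_powi_pos)
  show "real CARD('a) powi (- int n) < 1"
    using assms(3) CARD_powi_le_iff[of 0 "- int n", where 'a = 'a] by (simp flip: not_le)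
  show "abs_inf (denom n x / (f ^ n / (f - f') * x) - 1) \<le> real CARD('a) powi (- int n)"
    if "x \<in> conj_ideal (d - 1 - l)" "x \<noteq> 0" for x
    using i that by (rule denom_near)
qed (fact assms(1))+

end

section \<open>Passage to the limit and the multivalued limit\<close>

theorem theorem1:
  fixes emb :: "'a::finite_field fls alg_closure \<Rightarrow> 'c::{field, complete_space}"
    and a :: "'a poly" and b :: 'a and d :: nat
    and f \<pi> :: "'a fls" and \<xi> :: "'a fls set \<Rightarrow> 'c"
  assumes "C_infinity emb"
    and "Polynomial.lead_coeff a = 1" and "Polynomial.degree a = d" and "d \<ge> 1" and "b \<noteq> 0"
    and "f ^ 2 - of_A a * f - fls_const b = 0" and "abs_inf f = real CARD('a) ^ d"
    and "sgn_inf \<pi> = 1"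
    and "\<not> CHAR('a) dvd d \<Longrightarrow> \<pi> ^ d = inverse f"
    and "CHAR('a) dvd d \<Longrightarrow> \<pi> ^ (d + 1) = inverse (f * fls_X_inv)"
    and "\<And>\<Lambda>. \<Lambda> \<in> Lambda_eps f ` {0<..} \<union> ideal_a f d ` {..<d} \<Longrightarrow>
      \<xi> \<Lambda> ^ (CARD('a) - 1) =
        emb (to_ac (inverse (fls_const (eta \<Lambda>)) * \<pi> powi (- t_exp \<Lambda>) *
          u_lim \<pi> \<Lambda> ^ (CARD('a) - 1)))"
  defines "e_eps \<equiv> \<lambda>\<epsilon>. exp_scaled emb (\<xi> (Lambda_eps f \<epsilon>)) (Lambda_eps f \<epsilon>)"
    and "e \<equiv> \<lambda>i. exp_scaled emb (\<xi> (ideal_a f d i)) (ideal_a f d i)"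
  shows "(\<forall>z. \<forall>l<d.
      (\<lambda>N. e_eps (real CARD('a) powi (- int (d * N + l))) z) \<longlonglongrightarrow> e (d - 1 - l) z) \<and>
    (\<forall>z. multi_lim (\<lambda>\<epsilon>. e_eps \<epsilon> z) = {e i z | i. i < d})"
proof -
  interpret C_infinity emb by fact
  interpret quadratic_unit a b d f
    by standard (fact assms)+
  let ?q = "real CARD('a)"
  have X_inv: "fls_X_inv \<noteq> (0 :: 'a fls)" "deg_inf (fls_X_inv :: 'a fls) = 1"
    by (simp_all add: deg_inf_def)
  \<comment> \<open>Either root equation fixes the degree: \<open>\<pi>^d\<close> has degree
    \<open>- d\<close>, or \<open>\<pi>^(d+1)\<close> has degree \<open>- (d + 1)\<close>.\<close>
  have "deg_inf \<pi> = - 1"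
  proof (cases "CHAR('a) dvd d")
    case True
    then have "deg_inf (\<pi> ^ (d + 1)) = - (int d + 1)"
      using assms(10) f_nonzero X_inv by (simp add: deg_inf_inverse deg_inf_mult deg_f)
    then have "(int d + 1) * (deg_inf \<pi> + 1) = 0"
      unfolding deg_inf_power by (simp add: algebra_simps)
    then show ?thesis
      by (simp add: add_eq_0_iff) 
  next
    case False
    then have "deg_inf (\<pi> ^ d) = - int d"
      using assms(9) by (simp add: deg_inf_inverse deg_f)
    then have "int d * (deg_inf \<pi> + 1) = 0"
      unfolding deg_inf_power by (simp add: algebra_simps)
    with d_pos show ?thesis
      by simp
  qed
  with assms(8) have unif: "uniformizer \<pi>"
    by unfold_locales
  have scale: "is_scale \<pi> \<Lambda> (\<xi> \<Lambda>)" if "\<Lambda> \<in> Lambda_eps f ` {0<..} \<union> ideal_a f d ` {..<d}" for \<Lambda>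
    unfolding is_scale_def using assms(11)[OF that] .
  have tends: "(\<lambda>N. e_eps (?q powi (- int (d * N + l))) z) \<longlonglongrightarrow> e (d - 1 - l) z" if l: "l < d" for z l
  proof -
    have i: "d - 1 - l < d"
      using l by simp
    have eq: "conj_ideal (d - 1 - l) = ideal_a f d (d - 1 - l)"
      using ideal_a_eq[OF i] ..
    have "fq_lattice_uniformizer (conj_ideal (d - 1 - l)) \<pi>"
      using conj_ideal_lattice[OF i] unif by (rule fq_lattice_uniformizer.intro)
    moreover have "is_scale \<pi> (conj_ideal (d - 1 - l)) (\<xi> (conj_ideal (d - 1 - l)))"
      unfolding eq using i by (intro scale) blast
    ultimately obtain K where K: "\<And>\<Lambda>' \<phi> g s \<epsilon> \<xi>'. perturbation (conj_ideal (d - 1 - l)) \<Lambda>' \<pi> \<phi> g s \<epsilon> \<Longrightarrow>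
      is_scale \<pi> \<Lambda>' \<xi>' \<Longrightarrow> dist (exp_scaled emb \<xi>' \<Lambda>' z)
        (exp_scaled emb (\<xi> (conj_ideal (d - 1 - l))) (conj_ideal (d - 1 - l)) z) \<le> \<epsilon> * K"
      using exp_scaled_perturbation[where z = z] by blast
    have le: "dist (e_eps (?q powi (- int (d * N + l))) z) (e (d - 1 - l) z) \<le> ?q powi (- int N) * K"
      if "N \<ge> 1" for N
    proof -
      have "is_scale \<pi> (Lambda_eps f (?q powi (- int (d * N + l)))) (\<xi> (Lambda_eps f (?q powi (- int (d * N + l)))))"
        using CARD_powi_pos[where 'a = 'a] by (intro scale) blast
      from K[OF denom_perturbation[OF unif l that] this] show ?thesis
        unfolding e_eps_def e_def eq .
    qed
    have "(\<lambda>N. ?q powi (- int N) * K) \<longlonglongrightarrow> 0 * K"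
      by (intro tendsto_mult tendsto_const tendsto_CARD_powi)
    then have bound: "(\<lambda>N. ?q powi (- int N) * K) \<longlonglongrightarrow> 0"
      by (simp only: mult_zero_left)
    have "\<forall>\<^sub>F N in sequentially.
        dist (e_eps (?q powi (- int (d * N + l))) z) (e (d - 1 - l) z) \<le> ?q powi (- int N) * K"
      using le unfolding eventually_sequentially by blast
    from tendsto_sandwich[OF always_eventually[OF allI[OF zero_le_dist]] this tendsto_const bound]
    have "(\<lambda>N. dist (e_eps (?q powi (- int (d * N + l))) z) (e (d - 1 - l) z)) \<longlonglongrightarrow> 0" .
    then show ?thesis
      by (subst tendsto_dist_iff)
  qed
  have "multi_lim (\<lambda>\<epsilon>. e_eps \<epsilon> z) = {e i z | i. i < d}" for z
  proof (intro equalityI subsetI)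
    fix w assume "w \<in> {e i z | i. i < d}"
    then obtain i where i: "i < d" "w = e i z"
      by blast
    define l where "l = d - 1 - i"
    have l: "l < d" "d - 1 - l = i"
      using i by (auto simp: l_def)
    have "(\<lambda>N. ?q powi (- int (d * N + l))) \<longlonglongrightarrow> 0"
    proof -
      have "filterlim (\<lambda>N. d * N + l) at_top sequentially"
        by (rule filterlim_subseq) (use d_pos in \<open>auto simp: strict_mono_def\<close>)
      from filterlim_compose[OF tendsto_CARD_powi this] show ?thesis .
    qed
    moreover have "(\<lambda>N. e_eps (?q powi (- int (d * N + l))) z) \<longlonglongrightarrow> w"
      using tends[OF l(1)] unfolding l(2) i(2) .
    ultimately show "w \<in> multi_lim (\<lambda>\<epsilon>. e_eps \<epsilon> z)"
      unfolding multi_lim_def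
      by (intro CollectI exI[of _ "\<lambda>N. ?q powi (- int (d * N + l))"] conjI allI CARD_powi_pos)
  next
    fix w assume "w \<in> multi_lim (\<lambda>\<epsilon>. e_eps \<epsilon> z)"
    then obtain E where E: "\<And>n. E n > 0" "E \<longlonglongrightarrow> 0" "(\<lambda>n. e_eps (E n) z) \<longlonglongrightarrow> w"
      unfolding multi_lim_def by blast
    show "w \<in> {e i z | i. i < d}"
    proof (rule ccontr)
      assume w: "w \<notin> {e i z | i. i < d}"
      have "finite ((\<lambda>i. e i z) ` {..<d})"
        by simp
      \<comment> \<open>There are finitely many candidates, so a limit point outside them keeps a
        positive distance \<open>r\<close> from all of them, whereas \<open>e_eps (E n) z\<close>
        comes within \<open>r / 2\<close> of one of them.\<close>
      then obtain r where r: "r > 0" "\<And>i. i < d \<Longrightarrow> r \<le> dist w (e i z)"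
        using finite_set_avoid[of "(\<lambda>i. e i z) ` {..<d}" w] w by fastforce
      have "\<forall>\<^sub>F N in sequentially. \<forall>l\<in>{..<d}.
          dist (e_eps (?q powi (- int (d * N + l))) z) (e (d - 1 - l) z) < r / 2"
      proof (intro eventually_ball_finite ballI)
        fix l assume "l \<in> {..<d}"
        then show "\<forall>\<^sub>F N in sequentially.
            dist (e_eps (?q powi (- int (d * N + l))) z) (e (d - 1 - l) z) < r / 2"
          using r(1) by (intro tendstoD[OF tends]) simp_all
      qed simp
      then obtain N0 where N0: "\<And>N l. N \<ge> N0 \<Longrightarrow> l < d \<Longrightarrow>
          dist (e_eps (?q powi (- int (d * N + l))) z) (e (d - 1 - l) z) < r / 2"
        unfolding eventually_sequentially by blast
      have "\<forall>\<^sub>F n in sequentially. E n < ?q powi (- int (d * N0))"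
        using E(2) CARD_powi_pos[where 'a = 'a] by (rule order_tendstoD)
      moreover have "\<forall>\<^sub>F n in sequentially. dist (e_eps (E n) z) w < r / 2"
        using E(3) r(1) by (intro tendstoD) auto
      ultimately have "\<forall>\<^sub>F n in sequentially. E n < ?q powi (- int (d * N0)) \<and> dist (e_eps (E n) z) w < r / 2"
        by (rule eventually_conj)
      then obtain n where n: "E n < ?q powi (- int (d * N0))" "dist (e_eps (E n) z) w < r / 2"
        unfolding eventually_sequentially by blast
      \<comment> \<open>The least such \<open>k\<close> places \<open>E n\<close> above
        \<open>q^(-k-1)\<close> and at most at \<open>q^(-k)\<close>, so
        \<open>Lambda_eps_cong\<close> replaces \<open>E n\<close> by \<open>q^(-k)\<close>.\<close>
      define P where "P k \<longleftrightarrow> ?q powi (- int (Suc k)) < E n" for k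
      have "\<exists>k. P k"
      proof -
        obtain k :: nat where k: "?q powi (- int k) < E n"
          using E(1) by (rule CARD_powi_less_ex)
        moreover have "?q powi (- int (Suc k)) \<le> ?q powi (- int k)"
          unfolding CARD_powi_le_iff by simp
        ultimately show ?thesis
          unfolding P_def by (intro exI[of _ k]) linarith
      qed
      define k where "k = (LEAST k. P k)"
      have k: "P k"
        unfolding k_def using \<open>\<exists>k. P k\<close> by (rule LeastI_ex)
      have "?q powi (- int (Suc k)) < ?q powi (- int (d * N0))"
        using k n(1) unfolding P_def by linarith
      then have k_ge: "k \<ge> d * N0"
        unfolding CARD_powi_le_iff not_le[symmetric] by linarith
      have E_le: "E n \<le> ?q powi (- int k)"
      proof (cases k)
        \<comment> \<open>No smaller index is available for comparison; the upper bound comes from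
          \<open>E n < q^(-d N0) \<le> 1\<close>.\<close>
        case 0
        have "?q powi (- int (d * N0)) \<le> ?q powi (- int k)"
          unfolding CARD_powi_le_iff 0 by simp
        with n(1) show ?thesis by linarith
      next
        case (Suc m)
        then have "\<not> P m"
          unfolding k_def by (metis lessI not_less_Least)
        then show ?thesis
          unfolding P_def Suc by simp
      qed
      \<comment> \<open>Division of \<open>k\<close> by \<open>d\<close> yields
        \<open>N = k div d \<ge> N0\<close> and \<open>l = k mod d\<close>, to which the convergence
        along \<open>N\<close> applies.\<close>
      have "e_eps (E n) z = e_eps (?q powi (- int (d * (k div d) + k mod d))) z"
        unfolding e_eps_def using Lambda_eps_cong[of k "E n" f] k E_le by (simp add: P_def)
      moreover have "k div d \<ge> N0"
        using k_ge d_pos by (simp add: less_eq_div_iff_mult_less_eq mult.commute)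
      ultimately have "dist (e_eps (E n) z) (e (d - 1 - k mod d) z) < r / 2"
        using N0[of "k div d" "k mod d"] d_pos by simp
      then have "dist w (e (d - 1 - k mod d) z) < r"
        using n(2) dist_triangle3[of w "e (d - 1 - k mod d) z" "e_eps (E n) z"] by linarith
      moreover have "d - 1 - k mod d < d"
        using d_pos by simp
      ultimately show False
        using r(2) by fastforce
    qed
  qed
  with tends show ?thesis
    by blast
qed

end
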